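(* Consider the particle/antiparticle model described in the context, with $K\ge 1$ types of $(+)$-particles (velocities $v_1^{(+)}<\dots<v_K^{(+)}<0$, densities $\rho_k^{(+)}$) and $L\ge1$ types of $(-)$-particles (velocities $v_1^{(-)}>\dots>v_L^{(-)}>0$, densities $\rho_i^{(-)}$), and put $I_-=\{1,\dots,L\}$, $I_+=\{1,\dots,K\}$. Assume that $$\{V(J_-,J_+):\ \varnothing\ne J_-\subseteq I_-,\ \varnothing\neq J_+\subseteq I_+\}\cap\{v_1^{(-)},\dots,v_L^{(-)},v_1^{(+)},\dots,v_K^{(+)}\}=\varnothing .$$ Then the asymptotic velocity of the boundary, i.e. the almost sure limit $W=\lim_{t\to\infty}\beta(t)/t$, exists and equals $$W=V(\{1,\dots,L_1\},\{1,\dots,K_1\}),$$ where $$L_1=\max\{l\in\{1,\dots,L\}:\ v_l^{(-)}>V(\{1,\dots,l\},I_+)\},$$ $$K_1=\max\{k\in\{1,\dots,K\}:\ v_k^{(+)}<V(I_-,\{1,\dots,k\})\}.$$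
   Context: Model. At time $0$ there are on the real line infinitely many $(+)$-particles on the positive half-line, of types $k\in I_+=\{1,\dots,K\}$, and infinitely many $(-)$-particles on the negative half-line, of types $i\in I_-=\{1,\dots,L\}$. Initial positions of $(+)$-particles of type $k$ are $0<x_{1,k}<x_{2,k}<\cdots$, and those of $(-)$-particles of type $i$ are $\cdots<y_{2,i}<y_{1,i}<0$. With $x_{0,k}=y_{0,i}=0$, set $u^{(+)}_{j,k}=x_{j,k}-x_{j-1,k}$ and $u^{(-)}_{j,i}=y_{j-1,i}-y_{j,i}$ for $j\ge1$. All the random variables $u^{(+)}_{j,k},u^{(-)}_{j,i}$ are positive and mutually independent; the law of $u^{(+)}_{j,k}$ depends only on $k$ (and the sign $+$) and the law of $u^{(-)}_{j,i}$ only on $i$ (and the sign $-$); all these laws are absolutely continuous with finite means $\mu_k^{(+)}=E u^{(+)}_{j,k}$, $\mu_i^{(-)}=E u^{(-)}_{j,i}$. The densities are $\rho_k^{(+)}=1/\mu_k^{(+)}$, $\rho_i^{(-)}=1/\mu_i^{(-)}$. Dynamics. Each $(+)$-particle of type $k$ moves with constant velocity $v_k^{(+)}$ and each $(-)$-particle of type $i$ with constant velocity $v_i^{(-)}$. When a $(+)$-particle and a $(-)$-particle are at the same point (a collision), both disappear; there is no other interaction. (Almost surely no collision involves more than two particles.) Boundary. $\beta(t)$ is the coordinate of the last collision among those occurring at times $t'<t$ ($\beta(0)=0$, and $\beta(t)=0$ before any collision); its trajectories are piecewise constant and left continuous. Notation. For $J_-\subseteq I_-$, $J_+\subseteq I_+$,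 not both empty, $$V(J_-,J_+)=\frac{\sum_{i\in J_-}v_i^{(-)}\rho_i^{(-)}+\sum_{k\in J_+}v_k^{(+)}\rho_k^{(+)}}{\sum_{i\in J_-}\rho_i^{(-)}+\sum_{k\in J_+}\rho_k^{(+)}}.$$ The sets whose maxima define $L_1$ and $K_1$ always contain $1$. *)

theory Defs
  imports "HOL-Probability.Probability"
begin

text \<open>
  A particle is a pair \<open>(j, k)\<close>: the \<open>j\<close>-th particle of type \<open>k\<close>, counted from the origin.
  Throughout, \<open>gp j k\<close> and \<open>gm j i\<close> are the gaps of one realization of the initial configuration,
  \<open>vp k\<close> and \<open>vm i\<close> the velocities and \<open>rp k\<close> and \<open>rm i\<close> the densities of the types
  (\<open>p\<close> for plus, \<open>m\<close> for minus).
\<close>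

type_synonym particle = "nat \<times> nat"

definition particles :: "nat \<Rightarrow> particle set" where
  "particles n = {1..} \<times> {1..n}"

definition initial_distance :: "(nat \<Rightarrow> nat \<Rightarrow> real) \<Rightarrow> particle \<Rightarrow> real" where
  "initial_distance g p = (\<Sum>m = 1..fst p. g m (snd p))"

definition plus_position ::
  "(nat \<Rightarrow> real) \<Rightarrow> (nat \<Rightarrow> nat \<Rightarrow> real) \<Rightarrow> particle \<Rightarrow> real \<Rightarrow> real" where
  "plus_position vp gp p t = initial_distance gp p + vp (snd p) * t"

definition minus_position ::
  "(nat \<Rightarrow> real) \<Rightarrow> (nat \<Rightarrow> nat \<Rightarrow> real) \<Rightarrow> particle \<Rightarrow> real \<Rightarrow> real" where
  "minus_position vm gm q t = - initial_distance gm q + vm (snd q) * t"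

definition meeting_time ::
  "(nat \<Rightarrow> real) \<Rightarrow> (nat \<Rightarrow> real) \<Rightarrow> (nat \<Rightarrow> nat \<Rightarrow> real) \<Rightarrow> (nat \<Rightarrow> nat \<Rightarrow> real) \<Rightarrow>
   particle \<times> particle \<Rightarrow> real" where
  "meeting_time vp vm gp gm c =
     (initial_distance gp (fst c) + initial_distance gm (snd c)) /
     (vm (snd (snd c)) - vp (snd (fst c)))"

lemma positions_eq_iff_meeting_time:
  assumes "vp (snd p) < vm (snd q)"
  shows "plus_position vp gp p t = minus_position vm gm q t \<longleftrightarrow>
         t = meeting_time vp vm gp gm (p, q)"
  using assms
  by (auto simp: plus_position_def minus_position_def meeting_time_def field_simps)

text \<open>
  \<open>C\<close> is the set of collisions if a pair that would meet in free motion collides exactly when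
  neither of its members has disappeared before, that is, in a collision at a strictly earlier time.
\<close>

definition is_collision_set ::
  "'p set \<Rightarrow> 'q set \<Rightarrow> ('p \<times> 'q \<Rightarrow> real) \<Rightarrow> ('p \<times> 'q) set \<Rightarrow> bool" where
  "is_collision_set A B \<tau> C \<longleftrightarrow>
     C \<subseteq> A \<times> B \<and>
     (\<forall>p\<in>A. \<forall>q\<in>B. (p, q) \<in> C \<longleftrightarrow>
        \<not> (\<exists>(p', q')\<in>C. (p' = p \<or> q' = q) \<and> \<tau> (p', q') < \<tau> (p, q)))"

text \<open>
  If only finitely many meeting times lie below each bound, which holds almost surely for the
  model, then there is exactly one such set, so that the description operator in
  \<open>collisions\<close> below denotes it.
\<close>

lemma ex1_is_collision_set:
  assumes fin: "\<And>t. finite {c \<in> A \<times> B. \<tau> c < t}"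
  shows "\<exists>!C. is_collision_set A B \<tau> C"
proof -
  define R where "R = {(c', c). c' \<in> A \<times> B \<and> c \<in> A \<times> B \<and>
    (fst c' = fst c \<or> snd c' = snd c) \<and> \<tau> c' < \<tau> c}"
  have wf: "wf R"
  proof (rule wf_subset)
    show "wf (inv_image less_than (\<lambda>c. card {c' \<in> A \<times> B. \<tau> c' < \<tau> c}))" by simp
    show "R \<subseteq> inv_image less_than (\<lambda>c. card {c' \<in> A \<times> B. \<tau> c' < \<tau> c})"
    proof
      fix z assume "z \<in> R"
      then obtain c' c where z: "z = (c', c)" "c' \<in> A \<times> B" "\<tau> c' < \<tau> c"
        by (auto simp: R_def)
      have "card {d \<in> A \<times> B. \<tau> d < \<tau> c'} < card {d \<in> A \<times> B. \<tau> d < \<tau> c}"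
        by (rule psubset_card_mono[OF fin]) (use z in auto)
      with z show "z \<in> inv_image less_than (\<lambda>c. card {c' \<in> A \<times> B. \<tau> c' < \<tau> c})"
        by simp
    qed
  qed
  define P where "P = wfrec R (\<lambda>f c. \<forall>c'. (c', c) \<in> R \<longrightarrow> \<not> f c')"
  have P: "P c \<longleftrightarrow> (\<forall>c'. (c', c) \<in> R \<longrightarrow> \<not> P c')" for c
    unfolding P_def by (subst wfrec[OF wf]) (simp add: cut_apply)
  have char: "is_collision_set A B \<tau> C \<longleftrightarrow>
      C \<subseteq> A \<times> B \<and> (\<forall>c\<in>A \<times> B. c \<in> C \<longleftrightarrow> (\<forall>c'. (c', c) \<in> R \<longrightarrow> c' \<notin> C))" for C
  proof (cases "C \<subseteq> A \<times> B")
    case True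
    have "(\<not> (\<exists>(p', q')\<in>C. (p' = p \<or> q' = q) \<and> \<tau> (p', q') < \<tau> (p, q))) \<longleftrightarrow>
        (\<forall>c'. (c', (p, q)) \<in> R \<longrightarrow> c' \<notin> C)" if "p \<in> A" "q \<in> B" for p q
      using True that by (fastforce simp: R_def)
    with True show ?thesis unfolding is_collision_set_def by auto
  qed (simp add: is_collision_set_def)
  show ?thesis
  proof (rule ex1I)
    show "is_collision_set A B \<tau> {c \<in> A \<times> B. P c}"
      unfolding char
    proof (intro conjI ballI)
      fix c assume "c \<in> A \<times> B"
      moreover have "c' \<in> A \<times> B" if "(c', c) \<in> R" for c' using that by (auto simp: R_def)
      ultimately show "c \<in> {c \<in> A \<times> B. P c} \<longleftrightarrow>
          (\<forall>c'. (c', c) \<in> R \<longrightarrow> c' \<notin> {c \<in> A \<times> B. P c})"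
        using P[of c] by blast
    qed blast
  next
    fix C assume "is_collision_set A B \<tau> C"
    then have C: "C \<subseteq> A \<times> B" "\<And>c. c \<in> A \<times> B \<Longrightarrow> c \<in> C \<longleftrightarrow> (\<forall>c'. (c', c) \<in> R \<longrightarrow> c' \<notin> C)"
      unfolding char by auto
    have "c \<in> A \<times> B \<longrightarrow> (c \<in> C \<longleftrightarrow> P c)" for c
    proof (induction c rule: wf_induct_rule[OF wf])
      case (1 c)
      have "c' \<in> A \<times> B" if "(c', c) \<in> R" for c' using that by (auto simp: R_def)
      with 1 C(2)[of c] P[of c] show ?case by blast
    qed
    with C(1) show "C = {c \<in> A \<times> B. P c}" by blast
  qed
qed

definition collisions ::
  "nat \<Rightarrow> nat \<Rightarrow> (nat \<Rightarrow> real) \<Rightarrow> (nat \<Rightarrow> real) \<Rightarrow> (nat \<Rightarrow> nat \<Rightarrow> real) \<Rightarrow> (nat \<Rightarrow> nat \<Rightarrow> real) \<Rightarrow>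
   (particle \<times> particle) set" where
  "collisions K L vp vm gp gm =
     (THE C. is_collision_set (particles K) (particles L) (meeting_time vp vm gp gm) C)"

definition boundary ::
  "nat \<Rightarrow> nat \<Rightarrow> (nat \<Rightarrow> real) \<Rightarrow> (nat \<Rightarrow> real) \<Rightarrow> (nat \<Rightarrow> nat \<Rightarrow> real) \<Rightarrow> (nat \<Rightarrow> nat \<Rightarrow> real) \<Rightarrow>
   real \<Rightarrow> real" where
  "boundary K L vp vm gp gm t =
     (let \<tau> = meeting_time vp vm gp gm;
          S = {c \<in> collisions K L vp vm gp gm. \<tau> c < t};
          c = arg_max_on \<tau> S
      in if S = {} then 0 else plus_position vp gp (fst c) (\<tau> c))"

definition V ::
  "(nat \<Rightarrow> real) \<Rightarrow> (nat \<Rightarrow> real) \<Rightarrow> (nat \<Rightarrow> real) \<Rightarrow> (nat \<Rightarrow> real) \<Rightarrow> nat set \<Rightarrow> nat set \<Rightarrow> real"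
where
  "V vm rm vp rp Jm Jp =
     ((\<Sum>i\<in>Jm. vm i * rm i) + (\<Sum>k\<in>Jp. vp k * rp k)) / ((\<Sum>i\<in>Jm. rm i) + (\<Sum>k\<in>Jp. rp k))"

end

theory Submission
  imports Defs
begin

text \<open>
  If the boundary moves with velocity \<open>w\<close>, then per unit of time it is reached by
  \<open>\<Sum>k. rp k * max 0 (w - vp k)\<close> plus particles and by \<open>\<Sum>i. rm i * max 0 (vm i - w)\<close> minus particles.
  Since particles disappear in pairs, the velocity should be the one at which the two fluxes agree.
  Their difference is monotone in \<open>w\<close>, and comparing its sign at the velocities of the types shows that
  its zero is the value \<open>V {1..L1} {1..K1}\<close> (\<open>balance_velocity\<close>).

  That the boundary follows this velocity \<open>W\<close> is a statement about single realizations. It needs only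
  that each type has an asymptotic density and that no particle takes part in two collisions. The key
  observation is that at a collision all plus particles whose free motion leads to the left of it have
  already disappeared (\<open>dead_left_of_collision\<close>). So the numbers of particles killed are controlled
  from below by where the boundary is now and from above by where it has been. Compare a first
  collision beyond a line of slope \<open>W + 2 * \<theta>\<close> with the last previous one behind a line of slope
  \<open>W + \<theta>\<close>. In between, more plus than minus particles would have to be killed, unless the elapsed
  time is negligible, which bounded velocities exclude. Hence collisions stay below the line of slope
  \<open>W + \<epsilon>\<close>, up to a constant (\<open>upper_barrier\<close>), and by reflection above the line of slope \<open>W - \<epsilon>\<close>.
  As collisions do not pause for a time proportional to \<open>t\<close> (\<open>recent_collision\<close>), the position of the
  last one is asymptotic to \<open>W * t\<close>.

  The densities come from the strong law of large numbers for the gaps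
  (\<open>strong_law_of_large_numbers\<close>), which is derived from the maximal ergodic inequality and
  Kolmogorov's 0-1 law. Simultaneous meetings of one particle with two others of different types have
  probability zero since the gaps have densities (\<open>AE_quotients_differ\<close>).
\<close>

section \<open>The strong law of large numbers\<close>

text \<open>
  The largest of the partial sums of \<open>z\<close> with at most \<open>n\<close> terms; the empty sum counts, so it
  is never negative. The recursion peels off the first term, which relates the maximum for a
  sequence to the one for the shifted sequence.
\<close>

primrec max_prefix_sum :: "nat \<Rightarrow> (nat \<Rightarrow> real) \<Rightarrow> real" where
  "max_prefix_sum 0 z = 0"
| "max_prefix_sum (Suc n) z = max 0 (z 0 + max_prefix_sum n (\<lambda>i. z (Suc i)))"

lemma max_prefix_sum_nonneg: "0 \<le> max_prefix_sum n z"
  by (cases n) auto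

lemma max_prefix_sum_mono: "max_prefix_sum n z \<le> max_prefix_sum (Suc n) z"
proof (induction n arbitrary: z)
  case (Suc n)
  show ?case using Suc[of "\<lambda>i. z (Suc i)"] by simp
qed simp

lemma sum_le_max_prefix_sum: "j \<le> n \<Longrightarrow> (\<Sum>i<j. z i) \<le> max_prefix_sum n z"
proof (induction n arbitrary: z j)
  case (Suc n)
  show ?case
  proof (cases j)
    case 0
    then show ?thesis by (simp add: max_prefix_sum_nonneg del: max_prefix_sum.simps)
  next
    case (Suc k)
    then have "(\<Sum>i<k. z (Suc i)) \<le> max_prefix_sum n (\<lambda>i. z (Suc i))" using Suc.IH Suc.prems by simp
    then show ?thesis unfolding Suc sum.lessThan_Suc_shift by simp
  qed
qed simp

lemma max_prefix_sum_attained: "\<exists>j\<le>n. max_prefix_sum n z = (\<Sum>i<j. z i)"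
proof (induction n arbitrary: z)
  case (Suc n)
  obtain j where j: "j \<le> n" "max_prefix_sum n (\<lambda>i. z (Suc i)) = (\<Sum>i<j. z (Suc i))" using Suc by blast
  show ?case
  proof (cases "z 0 + max_prefix_sum n (\<lambda>i. z (Suc i)) \<le> 0")
    case True
    then show ?thesis by (intro exI[of _ 0]) auto
  next
    case False
    then show ?thesis using j by (intro exI[of _ "Suc j"]) (auto simp: sum.lessThan_Suc_shift simp del: sum.lessThan_Suc)
  qed
qed simp

lemma max_prefix_sum_le: "max_prefix_sum n z \<le> (\<Sum>i<n. \<bar>z i\<bar>)"
proof -
  obtain j where j: "j \<le> n" "max_prefix_sum n z = (\<Sum>i<j. z i)" using max_prefix_sum_attained by blast
  have "(\<Sum>i<j. z i) \<le> (\<Sum>i<j. \<bar>z i\<bar>)" by (intro sum_mono) auto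
  also have "\<dots> \<le> (\<Sum>i<n. \<bar>z i\<bar>)" using j by (intro sum_mono2) auto
  finally show ?thesis using j by simp
qed

lemma measurable_max_prefix_sum [measurable]:
  "max_prefix_sum n \<in> borel_measurable (\<Pi>\<^sub>M i\<in>UNIV. borel)"
proof (induction n)
  case (Suc n)
  have "(\<lambda>z i. z (Suc i)) \<in> measurable (\<Pi>\<^sub>M i\<in>UNIV. borel) (\<Pi>\<^sub>M i\<in>UNIV. (borel :: real measure))"
    by (rule measurable_PiM_single') auto
  from measurable_compose[OF this Suc] show ?case by simp
qed simp

context prob_space
begin

lemma indep_sets_reindex:
  assumes f: "inj_on f I" and F: "indep_sets F (f ` I)"
  shows "indep_sets (\<lambda>i. F (f i)) I"
proof (rule indep_setsI)
  show "F (f i) \<subseteq> events" if "i \<in> I" for i using F that by (auto simp: indep_sets_def)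
  fix A J assume J: "J \<noteq> {}" "J \<subseteq> I" "finite J" "\<forall>j\<in>J. A j \<in> F (f j)"
  have inj: "inj_on f J" using f J(2) by (rule inj_on_subset)
  define A' where "A' i = A (inv_into J f i)" for i
  have A': "A' (f j) = A j" if "j \<in> J" for j using inj that by (simp add: A'_def)
  have "prob (\<Inter>i\<in>f ` J. A' i) = (\<Prod>i\<in>f ` J. prob (A' i))"
    using J A' by (intro indep_setsD[OF F]) auto
  then show "prob (\<Inter>j\<in>J. A j) = (\<Prod>j\<in>J. prob (A j))"
    using A' inj by (simp add: prod.reindex cong: INF_cong)
qed

lemma indep_vars_reindex:
  assumes f: "inj_on f I" and X: "indep_vars M' X (f ` I)"
  shows "indep_vars (\<lambda>i. M' (f i)) (\<lambda>i. X (f i)) I"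
  using X indep_sets_reindex[OF f] unfolding indep_vars_def2 by auto

text \<open>
  An i.i.d. sequence and its shift have the same law on the sequence space, so that
  functionals of them have the same expectation.
\<close>

lemma distr_eq_shift:
  fixes Z :: "nat \<Rightarrow> 'a \<Rightarrow> real"
  assumes indep: "indep_vars (\<lambda>_. borel) Z UNIV"
    and same: "\<And>i. distr M borel (Z i) = distr M borel (Z 0)"
  shows "distr M (\<Pi>\<^sub>M i\<in>UNIV. borel) (\<lambda>\<omega> i. Z (Suc i) \<omega>) = distr M (\<Pi>\<^sub>M i\<in>UNIV. borel) (\<lambda>\<omega> i. Z i \<omega>)"
proof -
  have rv: "\<And>i. random_variable borel (Z i)" using indep by (simp add: indep_vars_def2)
  have indep': "indep_vars (\<lambda>_. borel) (\<lambda>i. Z (Suc i)) UNIV"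
    using indep_vars_reindex[where f=Suc and I=UNIV and X=Z and M'="\<lambda>_. borel"] indep_vars_subset[OF indep, of "range Suc"]
    by simp
  have "distr M (\<Pi>\<^sub>M i\<in>UNIV. borel) (\<lambda>\<omega> i. Z i \<omega>) = (\<Pi>\<^sub>M i\<in>UNIV. distr M borel (Z i))"
    using indep_vars_iff_distr_eq_PiM[where I=UNIV and M'="\<lambda>_. borel" and X=Z] indep rv
    by (simp add: restrict_UNIV)
  moreover have "distr M (\<Pi>\<^sub>M i\<in>UNIV. borel) (\<lambda>\<omega> i. Z (Suc i) \<omega>) = (\<Pi>\<^sub>M i\<in>UNIV. distr M borel (Z (Suc i)))"
    using indep_vars_iff_distr_eq_PiM[where I=UNIV and M'="\<lambda>_. borel" and X="\<lambda>i. Z (Suc i)"] indep' rv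
    by (simp add: restrict_UNIV)
  moreover have "distr M borel (Z (Suc i)) = distr M borel (Z i)" for i
    by (rule trans[OF same same[symmetric]])
  ultimately show ?thesis by simp
qed

text \<open>
  Whether the partial sums are bounded above does not depend on finitely many terms, so
  Kolmogorov's 0-1 law applies.
\<close>

lemma bounded_prefix_sums_0_1:
  fixes Z :: "nat \<Rightarrow> 'a \<Rightarrow> real"
  assumes indep: "indep_vars (\<lambda>_. borel) Z UNIV"
  shows "(AE \<omega> in M. \<exists>b::nat. \<forall>j. (\<Sum>i<j. Z i \<omega>) \<le> b) \<or>
    (AE \<omega> in M. \<not> (\<exists>b::nat. \<forall>j. (\<Sum>i<j. Z i \<omega>) \<le> b))"
proof -
  have rv [measurable]: "\<And>i. random_variable borel (Z i)" using indep by (simp add: indep_vars_def2)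
  define A where "A i = sigma_sets (space M) {Z i -` S \<inter> space M |S. S \<in> sets borel}" for i
  define E where "E = {\<omega> \<in> space M. \<exists>b::nat. \<forall>j. (\<Sum>i<j. Z i \<omega>) \<le> b}"
  have A_sub: "A i \<subseteq> Pow (space M)" for i
  proof
    fix S assume "S \<in> A i"
    then show "S \<in> Pow (space M)"
      unfolding A_def by (intro PowI sigma_sets_into_sp[of "{Z i -` S \<inter> space M |S. S \<in> sets borel}"]) auto
  qed
  have E_shift: "E = {\<omega> \<in> space M. \<exists>b::nat. \<forall>j. (\<Sum>i<j. Z (n + i) \<omega>) \<le> b}" for n
  proof -
    have split: "(\<Sum>i<n + j. Z i \<omega>) = (\<Sum>i<n. Z i \<omega>) + (\<Sum>i<j. Z (n + i) \<omega>)" for j \<omega>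
      by (induction j) auto
    have "(\<exists>b::nat. \<forall>j. (\<Sum>i<j. Z i \<omega>) \<le> b) \<longleftrightarrow> (\<exists>b::nat. \<forall>j. (\<Sum>i<j. Z (n + i) \<omega>) \<le> b)" for \<omega>
    proof
      assume "\<exists>b::nat. \<forall>j. (\<Sum>i<j. Z i \<omega>) \<le> b"
      then obtain b :: nat where b: "\<And>j. (\<Sum>i<j. Z i \<omega>) \<le> b" by blast
      obtain b' :: nat where b': "real b - (\<Sum>i<n. Z i \<omega>) \<le> b'" using real_arch_simple by blast
      have "(\<Sum>i<j. Z (n + i) \<omega>) \<le> b'" for j using b[of "n + j"] b' by (simp add: split)
      then show "\<exists>b::nat. \<forall>j. (\<Sum>i<j. Z (n + i) \<omega>) \<le> b" by blast
    next
      assume "\<exists>b::nat. \<forall>j. (\<Sum>i<j. Z (n + i) \<omega>) \<le> b"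
      then obtain b :: nat where b: "\<And>j. (\<Sum>i<j. Z (n + i) \<omega>) \<le> b" by blast
      obtain b' :: nat where b': "(\<Sum>i<n. \<bar>Z i \<omega>\<bar>) + b \<le> b'" using real_arch_simple by blast
      have "(\<Sum>i<j. Z i \<omega>) \<le> b'" for j
      proof (cases "j \<le> n")
        case True
        have "(\<Sum>i<j. Z i \<omega>) \<le> (\<Sum>i<j. \<bar>Z i \<omega>\<bar>)" by (intro sum_mono) auto
        also have "\<dots> \<le> (\<Sum>i<n. \<bar>Z i \<omega>\<bar>)" using True by (intro sum_mono2) auto
        finally show ?thesis using b' by simp
      next
        case False
        have "(\<Sum>i<n. Z i \<omega>) \<le> (\<Sum>i<n. \<bar>Z i \<omega>\<bar>)" by (intro sum_mono) auto
        then show ?thesis using split[of \<omega> "j - n"] b[of "j - n"] b' False by simp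
      qed
      then show "\<exists>b::nat. \<forall>j. (\<Sum>i<j. Z i \<omega>) \<le> b" by blast
    qed
    then show ?thesis by (simp add: E_def)
  qed
  have "E \<in> tail_events A"
    unfolding tail_events_def
  proof
    fix n
    define N where "N = sigma (space M) (\<Union> (A ` {n..}))"
    have sub: "\<Union> (A ` {n..}) \<subseteq> Pow (space M)" using A_sub by blast
    have spN: "space N = space M" by (simp add: N_def space_measure_of[OF sub])
    have setsN: "sets N = sigma_sets (space M) (\<Union> (A ` {n..}))" by (simp add: N_def sets_measure_of[OF sub])
    have mN [measurable]: "Z (n + i) \<in> borel_measurable N" for i
    proof (rule measurableI)
      fix S :: "real set" assume "S \<in> sets borel"
      then have "Z (n + i) -` S \<inter> space M \<in> A (n + i)" unfolding A_def by (auto intro!: sigma_sets.Basic)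
      then show "Z (n + i) -` S \<inter> space N \<in> sets N"
        unfolding setsN spN by (intro sigma_sets.Basic) auto
    qed simp
    have "{\<omega> \<in> space N. \<exists>b::nat. \<forall>j. (\<Sum>i<j. Z (n + i) \<omega>) \<le> b} \<in> sets N" by measurable
    then show "E \<in> sigma_sets (space M) (\<Union> (A ` {n..}))"
      unfolding setsN spN E_shift[of n] .
  qed
  moreover have "sigma_algebra (space M) (A i)" for i
    unfolding A_def by (rule sigma_algebra_sigma_sets) auto
  moreover have "indep_sets A UNIV"
    using indep unfolding indep_vars_def A_def by simp
  ultimately have "prob E = 0 \<or> prob E = 1" by (intro kolmogorov_0_1_law)
  moreover have "E \<in> events" unfolding E_def by measurable
  ultimately show ?thesis
    using AE_iff_measurable[of "space M - E"] prob_eq_0[of E] AE_prob_1[of E]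
    by (auto simp: E_def elim!: eventually_mono)
qed

text \<open>
  This follows Garsia's proof of the maximal ergodic theorem. Let \<open>m n\<close> and \<open>m' n\<close> be the
  maximal prefix sums of the sequence and of its shift. They have the same expectation, and
  \<open>m (Suc n) - m' n = max (- m' n) (Z 0)\<close>, hence the right-hand side has nonnegative
  expectation. If the partial sums were almost surely unbounded, it would tend to \<open>Z 0\<close>, whose
  expectation is negative.
\<close>

lemma bounded_prefix_sums:
  fixes Z :: "nat \<Rightarrow> 'a \<Rightarrow> real"
  assumes indep: "indep_vars (\<lambda>_. borel) Z UNIV"
    and same: "\<And>i. distr M borel (Z i) = distr M borel (Z 0)"
    and int: "integrable M (Z 0)" and neg: "expectation (Z 0) < 0"
  shows "AE \<omega> in M. \<exists>b. \<forall>j. (\<Sum>i<j. Z i \<omega>) \<le> b"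
proof -
  have rv [measurable]: "\<And>i. random_variable borel (Z i)" using indep by (simp add: indep_vars_def2)
  have int_all: "integrable M (Z i)" for i
  proof -
    have "integrable (distr M borel (Z 0)) (\<lambda>x. x)" using int by (subst integrable_distr_eq) auto
    then have "integrable (distr M borel (Z i)) (\<lambda>x. x)" by (subst same[of i])
    then show ?thesis by (subst (asm) integrable_distr_eq) auto
  qed
  define m where "m n \<omega> = max_prefix_sum n (\<lambda>i. Z i \<omega>)" for n \<omega>
  define m' where "m' n \<omega> = max_prefix_sum n (\<lambda>i. Z (Suc i) \<omega>)" for n \<omega>
  have pm [measurable]: "(\<lambda>\<omega> i. Z i \<omega>) \<in> measurable M (\<Pi>\<^sub>M i\<in>UNIV. borel)"
    "(\<lambda>\<omega> i. Z (Suc i) \<omega>) \<in> measurable M (\<Pi>\<^sub>M i\<in>UNIV. borel)"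
    by (rule measurable_PiM_single'; simp)+
  have mm [measurable]: "m n \<in> borel_measurable M" "m' n \<in> borel_measurable M" for n
    unfolding m_def m'_def by measurable
  have m_int: "integrable M (m n)" for n
  proof (rule Bochner_Integration.integrable_bound)
    show "integrable M (\<lambda>\<omega>. \<Sum>i<n. \<bar>Z i \<omega>\<bar>)" using int_all by auto
    show "AE \<omega> in M. norm (m n \<omega>) \<le> norm (\<Sum>i<n. \<bar>Z i \<omega>\<bar>)"
      using max_prefix_sum_le max_prefix_sum_nonneg by (auto simp: m_def intro!: AE_I2 order_trans[OF max_prefix_sum_le])
  qed simp
  have m'_int: "integrable M (m' n)" for n
  proof (rule Bochner_Integration.integrable_bound)
    show "integrable M (\<lambda>\<omega>. \<Sum>i<n. \<bar>Z (Suc i) \<omega>\<bar>)" using int_all by auto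
    show "AE \<omega> in M. norm (m' n \<omega>) \<le> norm (\<Sum>i<n. \<bar>Z (Suc i) \<omega>\<bar>)"
      using max_prefix_sum_le max_prefix_sum_nonneg by (auto simp: m'_def intro!: AE_I2 order_trans[OF max_prefix_sum_le])
  qed simp
  have same_exp: "expectation (m' n) = expectation (m n)" for n
  proof -
    have "expectation (m' n) = integral\<^sup>L (distr M (\<Pi>\<^sub>M i\<in>UNIV. borel) (\<lambda>\<omega> i. Z (Suc i) \<omega>)) (max_prefix_sum n)"
      unfolding m'_def by (subst integral_distr) auto
    also have "\<dots> = expectation (m n)"
      unfolding m_def distr_eq_shift[OF indep same] by (subst integral_distr) auto
    finally show ?thesis .
  qed
  have step: "m (Suc n) \<omega> - m' n \<omega> = max (- m' n \<omega>) (Z 0 \<omega>)" for n \<omega>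
    by (simp add: m_def m'_def)
  have nonneg: "0 \<le> expectation (\<lambda>\<omega>. max (- m' n \<omega>) (Z 0 \<omega>))" for n
  proof -
    have "expectation (m n) \<le> expectation (m (Suc n))"
      using m_int by (intro integral_mono) (auto simp: m_def max_prefix_sum_mono simp del: max_prefix_sum.simps)
    then have "0 \<le> expectation (\<lambda>\<omega>. m (Suc n) \<omega> - m' n \<omega>)"
      using m_int m'_int same_exp by simp
    then show ?thesis unfolding step .
  qed
  \<comment> \<open>The limit concerns the maxima \<open>m' n\<close>, so it is for the shifted sequence that almost sure
    unboundedness is refuted.\<close>
  have "\<not> (AE \<omega> in M. \<not> (\<exists>b::nat. \<forall>j. (\<Sum>i<j. Z (Suc i) \<omega>) \<le> b))"
  proof
    assume unb: "AE \<omega> in M. \<not> (\<exists>b::nat. \<forall>j. (\<Sum>i<j. Z (Suc i) \<omega>) \<le> b)"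
    have lim: "AE \<omega> in M. (\<lambda>n. max (- m' n \<omega>) (Z 0 \<omega>)) \<longlonglongrightarrow> Z 0 \<omega>"
      using unb
    proof eventually_elim
      fix \<omega> assume "\<not> (\<exists>b::nat. \<forall>j. (\<Sum>i<j. Z (Suc i) \<omega>) \<le> b)"
      moreover obtain b :: nat where "- Z 0 \<omega> \<le> b" using real_arch_simple by blast
      ultimately obtain j where j: "b < (\<Sum>i<j. Z (Suc i) \<omega>)" by (meson not_le)
      have "max (- m' n \<omega>) (Z 0 \<omega>) = Z 0 \<omega>" if "j \<le> n" for n
        using sum_le_max_prefix_sum[OF that, of "\<lambda>i. Z (Suc i) \<omega>"] j \<open>- Z 0 \<omega> \<le> b\<close>
        by (simp add: m'_def)
      then show "(\<lambda>n. max (- m' n \<omega>) (Z 0 \<omega>)) \<longlonglongrightarrow> Z 0 \<omega>"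
        by (intro tendsto_eventually) (auto simp: eventually_at_top_linorder)
    qed
    have "(\<lambda>n. expectation (\<lambda>\<omega>. max (- m' n \<omega>) (Z 0 \<omega>))) \<longlonglongrightarrow> expectation (Z 0)"
    proof (rule integral_dominated_convergence[where w="\<lambda>\<omega>. \<bar>Z 0 \<omega>\<bar>"])
      show "AE \<omega> in M. norm (max (- m' n \<omega>) (Z 0 \<omega>)) \<le> \<bar>Z 0 \<omega>\<bar>" for n
      proof (rule AE_I2)
        fix \<omega>
        have "0 \<le> m' n \<omega>" by (simp add: m'_def max_prefix_sum_nonneg)
        then show "norm (max (- m' n \<omega>) (Z 0 \<omega>)) \<le> \<bar>Z 0 \<omega>\<bar>" by auto
      qed
    qed (use int lim in auto)
    then have "0 \<le> expectation (Z 0)" by (rule LIMSEQ_le_const) (use nonneg in auto)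
    with neg show False by simp
  qed
  moreover have "indep_vars (\<lambda>_. borel) (\<lambda>i. Z (Suc i)) UNIV"
    using indep_vars_reindex[where f=Suc and I=UNIV and X=Z and M'="\<lambda>_. borel"] indep_vars_subset[OF indep, of "range Suc"]
    by simp
  ultimately have "AE \<omega> in M. \<exists>b::nat. \<forall>j. (\<Sum>i<j. Z (Suc i) \<omega>) \<le> b"
    using bounded_prefix_sums_0_1 by blast
  then show ?thesis
  proof eventually_elim
    fix \<omega> assume "\<exists>b::nat. \<forall>j. (\<Sum>i<j. Z (Suc i) \<omega>) \<le> b"
    then obtain b :: nat where b: "\<And>j. (\<Sum>i<j. Z (Suc i) \<omega>) \<le> b" by blast
    have "(\<Sum>i<j. Z i \<omega>) \<le> \<bar>Z 0 \<omega>\<bar> + b" for j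
    proof (cases j)
      case (Suc k)
      show ?thesis unfolding Suc sum.lessThan_Suc_shift using b[of k] by simp
    qed simp
    then show "\<exists>b. \<forall>j. (\<Sum>i<j. Z i \<omega>) \<le> b" by blast
  qed
qed

lemma strong_law_upper:
  fixes X :: "nat \<Rightarrow> 'a \<Rightarrow> real"
  assumes indep: "indep_vars (\<lambda>_. borel) X UNIV"
    and same: "\<And>i. distr M borel (X i) = distr M borel (X 0)"
    and int: "integrable M (X 0)"
  shows "AE \<omega> in M. \<forall>e>0. \<forall>\<^sub>F n in sequentially. (\<Sum>i<n. X i \<omega>) / n < expectation (X 0) + e"
proof -
  have rv [measurable]: "\<And>i. random_variable borel (X i)" using indep by (simp add: indep_vars_def2)
  have "AE \<omega> in M. \<exists>b. \<forall>j. (\<Sum>i<j. X i \<omega> - (expectation (X 0) + 1 / Suc r)) \<le> b" for r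
  proof (rule bounded_prefix_sums)
    define a where "a = expectation (X 0) + 1 / Suc r"
    show "indep_vars (\<lambda>_. borel) (\<lambda>i \<omega>. X i \<omega> - (expectation (X 0) + 1 / Suc r)) UNIV"
      by (rule indep_vars_compose2[OF indep, where Y="\<lambda>_ x. x - (expectation (X 0) + 1 / Suc r)"]) simp
    have "distr M borel (\<lambda>\<omega>. X i \<omega> - a) = distr (distr M borel (X i)) borel (\<lambda>x. x - a)" for i
      by (simp add: distr_distr comp_def)
    then show "distr M borel (\<lambda>\<omega>. X i \<omega> - (expectation (X 0) + 1 / Suc r)) =
        distr M borel (\<lambda>\<omega>. X 0 \<omega> - (expectation (X 0) + 1 / Suc r))" for i
      using same[of i] by (simp add: a_def)
    show "integrable M (\<lambda>\<omega>. X 0 \<omega> - (expectation (X 0) + 1 / Suc r))" using int by simp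
    show "expectation (\<lambda>\<omega>. X 0 \<omega> - (expectation (X 0) + 1 / Suc r)) < 0"
      using int by (simp add: prob_space)
  qed
  then have "AE \<omega> in M. \<forall>r::nat. \<exists>b. \<forall>j. (\<Sum>i<j. X i \<omega> - (expectation (X 0) + 1 / Suc r)) \<le> b"
    unfolding AE_all_countable by blast
  then show ?thesis
  proof eventually_elim
    fix \<omega> assume bnd: "\<forall>r::nat. \<exists>b. \<forall>j. (\<Sum>i<j. X i \<omega> - (expectation (X 0) + 1 / Suc r)) \<le> b"
    show "\<forall>e>0. \<forall>\<^sub>F n in sequentially. (\<Sum>i<n. X i \<omega>) / n < expectation (X 0) + e"
    proof (intro allI impI)
      fix e :: real assume e: "0 < e"
      then obtain r :: nat where r: "1 / Suc r < e / 2" using nat_approx_posE[of "e / 2"] by auto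
      obtain b where b: "\<And>j. (\<Sum>i<j. X i \<omega> - (expectation (X 0) + 1 / Suc r)) \<le> b" using bnd by blast
      obtain n0 :: nat where n0: "2 * \<bar>b\<bar> / e < n0" using reals_Archimedean2 by blast
      have "(\<Sum>i<n. X i \<omega>) / n < expectation (X 0) + e" if "max n0 1 \<le> n" for n
      proof -
        have n: "0 < real n" "n0 \<le> real n" using that by auto
        \<comment> \<open>One half of \<open>e\<close> absorbs \<open>b / n\<close>, the other half the excess \<open>1 / Suc r\<close>.\<close>
        have "2 * \<bar>b\<bar> / e < n" using n0 n by linarith
        then have "b < e / 2 * n" using e by (simp add: field_simps)
        moreover have "(1 / Suc r) * real n \<le> e / 2 * real n" using r n by (intro mult_right_mono) auto
        moreover have "(\<Sum>i<n. X i \<omega>) \<le> b + (expectation (X 0) + 1 / Suc r) * n"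
          using b[of n] by (simp add: sum_subtractf mult.commute)
        ultimately have "(\<Sum>i<n. X i \<omega>) < (expectation (X 0) + e) * n" unfolding distrib_right by linarith
        then show ?thesis using n by (simp add: field_simps)
      qed
      then show "\<forall>\<^sub>F n in sequentially. (\<Sum>i<n. X i \<omega>) / n < expectation (X 0) + e"
        unfolding eventually_at_top_linorder by blast
    qed
  qed
qed

lemma strong_law_of_large_numbers:
  fixes X :: "nat \<Rightarrow> 'a \<Rightarrow> real"
  assumes indep: "indep_vars (\<lambda>_. borel) X UNIV"
    and same: "\<And>i. distr M borel (X i) = distr M borel (X 0)"
    and int: "integrable M (X 0)"
  shows "AE \<omega> in M. (\<lambda>n. (\<Sum>i<n. X i \<omega>) / n) \<longlonglongrightarrow> expectation (X 0)"
proof -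
  have rv [measurable]: "\<And>i. random_variable borel (X i)" using indep by (simp add: indep_vars_def2)
  have "AE \<omega> in M. \<forall>e>0. \<forall>\<^sub>F n in sequentially. (\<Sum>i<n. - X i \<omega>) / n < expectation (\<lambda>\<omega>. - X 0 \<omega>) + e"
  proof (rule strong_law_upper)
    show "indep_vars (\<lambda>_. borel) (\<lambda>i \<omega>. - X i \<omega>) UNIV"
      by (rule indep_vars_compose2[OF indep, where Y="\<lambda>_ x. - x"]) simp
    have "distr M borel (\<lambda>\<omega>. - X i \<omega>) = distr (distr M borel (X i)) borel (\<lambda>x. - x)" for i
      by (simp add: distr_distr comp_def)
    then show "distr M borel (\<lambda>\<omega>. - X i \<omega>) = distr M borel (\<lambda>\<omega>. - X 0 \<omega>)" for i
      using same[of i] by simp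
  qed (use int in simp)
  with strong_law_upper[OF assms] show ?thesis
  proof eventually_elim
    fix \<omega>
    assume up: "\<forall>e>0. \<forall>\<^sub>F n in sequentially. (\<Sum>i<n. X i \<omega>) / n < expectation (X 0) + e"
      and lo: "\<forall>e>0. \<forall>\<^sub>F n in sequentially. (\<Sum>i<n. - X i \<omega>) / n < expectation (\<lambda>\<omega>. - X 0 \<omega>) + e"
    show "(\<lambda>n. (\<Sum>i<n. X i \<omega>) / n) \<longlonglongrightarrow> expectation (X 0)"
    proof (rule tendstoI)
      fix e :: real assume e: "0 < e"
      show "\<forall>\<^sub>F n in sequentially. dist ((\<Sum>i<n. X i \<omega>) / n) (expectation (X 0)) < e"
        using up[rule_format, OF e] lo[rule_format, OF e]
        by eventually_elim (auto simp: dist_real_def abs_less_iff sum_negf)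
    qed
  qed
qed

end

section \<open>Almost sure absence of coincidences\<close>

context prob_space
begin

text \<open>
  Condition on \<open>R\<close>: by Fubini's theorem the probability of \<open>U = R\<close> is an average of
  probabilities of \<open>U = r\<close>.
\<close>

lemma AE_neq_of_indep:
  fixes U R :: "'a \<Rightarrow> real"
  assumes indep: "indep_var borel U borel R" and atomless: "\<And>r. AE \<omega> in M. U \<omega> \<noteq> r"
  shows "AE \<omega> in M. U \<omega> \<noteq> R \<omega>"
proof -
  have rv [measurable]: "random_variable borel R" "random_variable borel U"
    using indep indep_var_rv1 indep_var_rv2 by blast+
  interpret U: prob_space "distr M borel U" by (rule prob_space_distr) simp
  interpret R: prob_space "distr M borel R" by (rule prob_space_distr) simp
  interpret UR: pair_sigma_finite "distr M borel U" "distr M borel R" ..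
  define S where "S = {z \<in> space (borel \<Otimes>\<^sub>M borel). fst z = (snd z :: real)}"
  have S: "S \<in> sets (borel \<Otimes>\<^sub>M borel)" unfolding S_def by measurable
  have null: "emeasure (distr M borel U) {r} = 0" for r
  proof -
    have "emeasure (distr M borel U) {r} = emeasure M {\<omega> \<in> space M. U \<omega> = r}"
      by (subst emeasure_distr) (auto intro!: arg_cong[where f="emeasure M"])
    also have "\<dots> = 0"
      using atomless[of r] by (subst (asm) AE_iff_measurable[OF _ refl]) auto
    finally show ?thesis .
  qed
  have "emeasure (distr M borel U \<Otimes>\<^sub>M distr M borel R) S =
      (\<integral>\<^sup>+ r. emeasure (distr M borel U) ((\<lambda>u. (u, r)) -` S) \<partial>distr M borel R)"
    using S by (intro UR.emeasure_pair_measure_alt2) (simp cong: sets_pair_measure_cong)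
  also have "(\<lambda>r. (\<lambda>u. (u, r)) -` S) = (\<lambda>r. {r})" by (auto simp: S_def space_pair_measure fun_eq_iff)
  also have "(\<integral>\<^sup>+ r. emeasure (distr M borel U) {r} \<partial>distr M borel R) = 0" by (simp add: null)
  finally have "emeasure (distr M borel U \<Otimes>\<^sub>M distr M borel R) S = 0" .
  then have "emeasure (distr M (borel \<Otimes>\<^sub>M borel) (\<lambda>\<omega>. (U \<omega>, R \<omega>))) S = 0"
    using indep by (simp add: indep_var_distribution_eq)
  then have "emeasure M ((\<lambda>\<omega>. (U \<omega>, R \<omega>)) -` S \<inter> space M) = 0"
    using S by (subst (asm) emeasure_distr) auto
  also have "(\<lambda>\<omega>. (U \<omega>, R \<omega>)) -` S \<inter> space M = {\<omega> \<in> space M. \<not> U \<omega> \<noteq> R \<omega>}"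
    by (auto simp: S_def space_pair_measure)
  finally show ?thesis by (subst AE_iff_measurable[OF _ refl]) auto
qed

lemma AE_linear_combination_neq_0:
  fixes U :: "'i \<Rightarrow> 'a \<Rightarrow> real"
  assumes J: "finite J" "a \<in> J" and indep: "indep_vars (\<lambda>_. borel) U J" and c: "c a \<noteq> 0"
    and atomless: "\<And>r. AE \<omega> in M. U a \<omega> \<noteq> r"
  shows "AE \<omega> in M. (\<Sum>j\<in>J. c j * U j \<omega>) \<noteq> 0"
proof -
  have ins: "insert a (J - {a}) = J" using J by blast
  have "indep_vars (\<lambda>_. borel) (\<lambda>j \<omega>. c j * U j \<omega>) J"
    by (rule indep_vars_compose2[OF indep, where Y="\<lambda>j x. c j * x"]) simp
  then have "indep_var borel (\<lambda>\<omega>. c a * U a \<omega>) borel (\<lambda>\<omega>. \<Sum>j\<in>J - {a}. c j * U j \<omega>)"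
    using indep_vars_sum[of "J - {a}" a "\<lambda>j \<omega>. c j * U j \<omega>"] J ins by simp
  from indep_var_compose[OF this, of "\<lambda>x. x" borel "\<lambda>x. - x" borel]
  have "indep_var borel (\<lambda>\<omega>. c a * U a \<omega>) borel (\<lambda>\<omega>. - (\<Sum>j\<in>J - {a}. c j * U j \<omega>))"
    by (simp add: comp_def)
  moreover have "AE \<omega> in M. c a * U a \<omega> \<noteq> r" for r
    using atomless[of "r / c a"] by eventually_elim (use c in auto)
  ultimately have "AE \<omega> in M. c a * U a \<omega> \<noteq> - (\<Sum>j\<in>J - {a}. c j * U j \<omega>)"
    by (rule AE_neq_of_indep)
  then show ?thesis
  proof eventually_elim
    fix \<omega> assume "c a * U a \<omega> \<noteq> - (\<Sum>j\<in>J - {a}. c j * U j \<omega>)"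
    moreover have "(\<Sum>j\<in>J. c j * U j \<omega>) = c a * U a \<omega> + (\<Sum>j\<in>J - {a}. c j * U j \<omega>)"
      by (rule sum.remove[OF J])
    ultimately show "(\<Sum>j\<in>J. c j * U j \<omega>) \<noteq> 0" by linarith
  qed
qed

text \<open>
  A sum \<open>P\<close> shared by two quotients with different denominators enters their difference with
  the nonzero coefficient \<open>1 / w - 1 / w'\<close>. One atomless summand of \<open>P\<close> that is independent of
  the rest thus makes the quotients differ almost surely.
\<close>

lemma AE_quotients_differ:
  fixes U :: "'i \<Rightarrow> 'a \<Rightarrow> real"
  assumes fin: "finite P" "finite Q" "finite Q'"
    and disj: "P \<inter> Q = {}" "P \<inter> Q' = {}" "Q \<inter> Q' = {}" and a: "a \<in> P"
    and indep: "indep_vars (\<lambda>_. borel) U (P \<union> Q \<union> Q')"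
    and atomless: "\<And>r. AE \<omega> in M. U a \<omega> \<noteq> r"
    and w: "w \<noteq> w'" "w \<noteq> 0" "w' \<noteq> 0"
  shows "AE \<omega> in M. ((\<Sum>j\<in>P. U j \<omega>) + (\<Sum>j\<in>Q. U j \<omega>)) / w \<noteq> ((\<Sum>j\<in>P. U j \<omega>) + (\<Sum>j\<in>Q'. U j \<omega>)) / w'"
proof -
  define c where "c j = (if j \<in> P then 1 / w - 1 / w' else if j \<in> Q then 1 / w else - 1 / w')" for j
  have ca: "c a \<noteq> 0" using a w by (simp add: c_def)
  have "AE \<omega> in M. (\<Sum>j\<in>P \<union> Q \<union> Q'. c j * U j \<omega>) \<noteq> 0"
    using fin a by (intro AE_linear_combination_neq_0[OF _ _ indep, of a] ca atomless) auto
  then show ?thesis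
  proof eventually_elim
    fix \<omega> assume nz: "(\<Sum>j\<in>P \<union> Q \<union> Q'. c j * U j \<omega>) \<noteq> 0"
    have "(\<Sum>j\<in>P \<union> Q \<union> Q'. c j * U j \<omega>) =
        (\<Sum>j\<in>P. c j * U j \<omega>) + (\<Sum>j\<in>Q. c j * U j \<omega>) + (\<Sum>j\<in>Q'. c j * U j \<omega>)"
      using fin disj by (subst sum.union_disjoint; (subst sum.union_disjoint)?; auto)
    also have "(\<Sum>j\<in>P. c j * U j \<omega>) = (1 / w - 1 / w') * (\<Sum>j\<in>P. U j \<omega>)"
      unfolding sum_distrib_left by (intro sum.cong) (auto simp: c_def)
    also have "(\<Sum>j\<in>Q. c j * U j \<omega>) = 1 / w * (\<Sum>j\<in>Q. U j \<omega>)"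
      unfolding sum_distrib_left using disj by (intro sum.cong) (auto simp: c_def)
    also have "(\<Sum>j\<in>Q'. c j * U j \<omega>) = - 1 / w' * (\<Sum>j\<in>Q'. U j \<omega>)"
      unfolding sum_distrib_left using disj by (intro sum.cong) (auto simp: c_def)
    finally show "((\<Sum>j\<in>P. U j \<omega>) + (\<Sum>j\<in>Q. U j \<omega>)) / w \<noteq> ((\<Sum>j\<in>P. U j \<omega>) + (\<Sum>j\<in>Q'. U j \<omega>)) / w'"
      using nz by (auto simp: algebra_simps add_divide_distrib)
  qed
qed

lemma AE_neq_of_absolutely_continuous:
  fixes U :: "'a \<Rightarrow> real"
  assumes [measurable]: "random_variable borel U" and ac: "absolutely_continuous lborel (distr M borel U)"
  shows "AE \<omega> in M. U \<omega> \<noteq> r"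
proof -
  have "{r} \<in> null_sets lborel" by (simp add: null_sets_def)
  then have "{r} \<in> null_sets (distr M borel U)" using ac by (auto simp: absolutely_continuous_def)
  then have "AE x in distr M borel U. x \<noteq> r" by (auto dest: AE_not_in)
  then show ?thesis by (subst (asm) AE_distr_iff) auto
qed

end

section \<open>Point sequences with an asymptotic density\<close>

text \<open>
  The points \<open>x p\<close>, \<open>p \<in> A\<close>, have asymptotic density \<open>\<rho>\<close> on the positive half-line: the number
  of points below \<open>a\<close> is \<open>\<rho> * a + o(a)\<close>. The error term is written as \<open>\<delta> * a + D\<close> with \<open>\<delta>\<close>
  arbitrarily small and \<open>D\<close> depending on \<open>\<delta>\<close>, which makes the bound valid for all \<open>a \<ge> 0\<close>.
\<close>

definition has_density :: "real \<Rightarrow> 'p set \<Rightarrow> ('p \<Rightarrow> real) \<Rightarrow> bool" where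
  "has_density \<rho> A x \<longleftrightarrow>
     (\<forall>\<delta>>0. \<exists>D. \<forall>a\<ge>0. finite {p \<in> A. x p < a} \<and>
        \<bar>real (card {p \<in> A. x p < a}) - \<rho> * a\<bar> \<le> \<delta> * a + D)"

lemma linear_bound_of_tendsto:
  fixes f :: "nat \<Rightarrow> real" and x :: "nat \<Rightarrow> real"
  assumes lim: "(\<lambda>j. f j / x j) \<longlonglongrightarrow> \<rho>" and pos: "\<And>j. j \<ge> 1 \<Longrightarrow> x j > 0" and \<delta>: "\<delta> > 0"
  shows "\<exists>D\<ge>0. \<forall>j\<ge>1. \<bar>f j - \<rho> * x j\<bar> \<le> \<delta> * x j + D"
proof -
  obtain n where n: "\<And>j. j \<ge> n \<Longrightarrow> \<bar>f j / x j - \<rho>\<bar> < \<delta>"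
    using LIMSEQ_D[OF lim \<delta>] by auto
  define D where "D = (\<Sum>j<n. \<bar>f j - \<rho> * x j\<bar>)"
  have Dnn: "D \<ge> 0" by (simp add: D_def sum_nonneg)
  have "\<bar>f j - \<rho> * x j\<bar> \<le> \<delta> * x j + D" if j: "j \<ge> 1" for j
  proof (cases "j < n")
    case True
    have "\<bar>f j - \<rho> * x j\<bar> \<le> D" unfolding D_def
      by (rule member_le_sum[where f="\<lambda>j. \<bar>f j - \<rho> * x j\<bar>"]) (use True in auto)
    moreover have "0 \<le> \<delta> * x j" using pos[OF j] \<delta> by simp
    ultimately show ?thesis by simp
  next
    case False
    have "\<bar>f j - \<rho> * x j\<bar> = \<bar>f j / x j - \<rho>\<bar> * x j"
    proof -
      have "f j - \<rho> * x j = (f j / x j - \<rho>) * x j" using pos[OF j] by (simp add: field_simps)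
      then show ?thesis using pos[OF j] by (simp add: abs_mult)
    qed
    also have "\<dots> \<le> \<delta> * x j" using n[of j] False pos[OF j] by (intro mult_right_mono) auto
    finally show ?thesis using Dnn by simp
  qed
  moreover note Dnn
  ultimately show ?thesis by blast
qed

lemma has_density_sequence:
  fixes x :: "nat \<Rightarrow> real"
  assumes lim: "(\<lambda>j. x j / j) \<longlonglongrightarrow> \<mu>" and \<mu>: "\<mu> > 0"
    and pos: "\<And>j. j \<ge> 1 \<Longrightarrow> x j > 0" and mono: "\<And>i j. 1 \<le> i \<Longrightarrow> i \<le> j \<Longrightarrow> x i \<le> x j"
  shows "has_density (1 / \<mu>) {1..} x"
  unfolding has_density_def
proof (intro allI impI)
  fix \<delta> :: real assume \<delta>: "\<delta> > 0"
  have "(\<lambda>j. inverse (x j / j)) \<longlonglongrightarrow> inverse \<mu>"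
    using lim \<mu> by (intro tendsto_inverse) auto
  then have "(\<lambda>j. real j / x j) \<longlonglongrightarrow> 1 / \<mu>" by (simp add: inverse_eq_divide)
  from linear_bound_of_tendsto[OF this pos \<delta>] obtain D where D: "D \<ge> 0"
    "\<And>j. j \<ge> 1 \<Longrightarrow> \<bar>real j - 1 / \<mu> * x j\<bar> \<le> \<delta> * x j + D" by auto
  show "\<exists>D. \<forall>a\<ge>0. finite {p \<in> {1..}. x p < a} \<and>
        \<bar>real (card {p \<in> {1..}. x p < a}) - 1 / \<mu> * a\<bar> \<le> \<delta> * a + D"
  proof (intro exI[of _ "D + 1"] allI impI conjI)
    fix a :: real assume a: "a \<ge> 0"
    define S where "S = {p \<in> {1..}. x p < a}"
    have le: "real j \<le> (1 / \<mu> + \<delta>) * a + D" if "j \<in> S" for j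
    proof -
      have "real j \<le> (1 / \<mu> + \<delta>) * x j + D" using D(2)[of j] that by (auto simp: S_def algebra_simps)
      also have "\<dots> \<le> (1 / \<mu> + \<delta>) * a + D" using that \<mu> \<delta> by (intro add_right_mono mult_left_mono) (auto simp: S_def)
      finally show ?thesis .
    qed
    have "S \<subseteq> {..nat \<lfloor>(1 / \<mu> + \<delta>) * a + D\<rfloor>}"
      using le by (auto intro: le_nat_floor)
    then show fin: "finite {p \<in> {1..}. x p < a}" using finite_subset unfolding S_def by blast
    \<comment> \<open>By monotonicity the indices of the points below \<open>a\<close> form an initial segment.\<close>
    have "\<exists>n. S = {1..n}"
    proof (cases "S = {}")
      case False
      have "S = {1..Max S}"
      proof
        show "S \<subseteq> {1..Max S}" using fin by (auto simp: S_def)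
        have "Max S \<in> S" using Max_in[of S] False fin by (simp add: S_def)
        then show "{1..Max S} \<subseteq> S" using mono by (force simp: S_def intro: le_less_trans)
      qed
      then show ?thesis by blast
    qed auto
    then obtain n where n: "S = {1..n}" by blast
    have "real n \<le> (1 / \<mu> + \<delta>) * a + D"
    proof (cases "n = 0")
      case True
      then show ?thesis using a \<mu> \<delta> D(1) by simp
    next
      case False
      then show ?thesis using le[of n] n by auto
    qed
    moreover have "(1 / \<mu> - \<delta>) * a \<le> real n + 1 + D"
    proof (cases "\<delta> \<le> 1 / \<mu>")
      case True
      have "Suc n \<notin> S" using n by auto
      then have "a \<le> x (Suc n)" by (auto simp: S_def)
      then have "(1 / \<mu> - \<delta>) * a \<le> (1 / \<mu> - \<delta>) * x (Suc n)" using True by (intro mult_left_mono) auto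
      also have "\<dots> \<le> real n + 1 + D" using D(2)[of "Suc n"] by (simp add: algebra_simps)
      finally show ?thesis .
    next
      case False
      then have "(1 / \<mu> - \<delta>) * a \<le> 0" using a by (intro mult_nonpos_nonneg) auto
      then show ?thesis using D(1) by linarith
    qed
    ultimately show "\<bar>real (card {p \<in> {1..}. x p < a}) - 1 / \<mu> * a\<bar> \<le> \<delta> * a + (D + 1)"
      using n unfolding S_def[symmetric] by (simp add: algebra_simps abs_le_iff)
  qed
qed

lemma has_density_image:
  assumes "has_density \<rho> A (x \<circ> f)" and "inj_on f A"
  shows "has_density \<rho> (f ` A) x"
proof -
  have "{p \<in> f ` A. x p < a} = f ` {p \<in> A. (x \<circ> f) p < a}" for a by auto
  moreover have "inj_on f {p \<in> A. (x \<circ> f) p < a}" for a using assms(2) by (rule inj_on_subset) auto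
  ultimately show ?thesis using assms(1) unfolding has_density_def
    by (simp add: card_image finite_image_iff)
qed

lemma has_density_finite:
  assumes "has_density \<rho> A x"
  shows "finite {p \<in> A. x p < a}"
proof -
  have "finite {p \<in> A. x p < max a 0}"
    using assms unfolding has_density_def by (metis max.cobounded2 zero_less_one)
  then show ?thesis by (rule finite_subset[rotated]) auto
qed

text \<open>
  The bounds hold for half-open intervals, whose counts are differences of the counts in the
  definition. The upper bound also covers intervals that reach below \<open>0\<close>, where there are no
  points.
\<close>

lemma has_density_interval:
  assumes d: "has_density \<rho> A x" and "\<rho> \<ge> 0" and pos: "\<And>p. p \<in> A \<Longrightarrow> 0 < x p" and \<delta>: "\<delta> > 0"
  shows "\<exists>D\<ge>0. \<forall>a b. a \<le> b \<longrightarrow>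
      real (card {p \<in> A. a \<le> x p \<and> x p < b}) \<le> \<rho> * (b - a) + \<delta> * \<bar>b\<bar> + D \<and>
      (0 \<le> a \<longrightarrow> \<rho> * (b - a) - \<delta> * b - D \<le> real (card {p \<in> A. a \<le> x p \<and> x p < b}))"
proof -
  define n where "n a = real (card {p \<in> A. x p < a})" for a
  have n0: "n a = 0" if "a \<le> 0" for a
  proof -
    have "{p \<in> A. x p < a} = {}" using pos that by force
    then show ?thesis unfolding n_def by (simp only: card.empty of_nat_0)
  qed
  obtain D0 where D0: "\<And>a. a \<ge> 0 \<Longrightarrow> \<bar>n a - \<rho> * a\<bar> \<le> \<delta> / 2 * a + D0"
    using d[unfolded has_density_def, rule_format, of "\<delta> / 2"] \<delta> unfolding n_def by auto
  have D0nn: "D0 \<ge> 0" using D0[of 0] n0[of 0] by simp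
  have diff: "real (card {p \<in> A. a \<le> x p \<and> x p < b}) = n b - n a" if "a \<le> b" for a b
  proof -
    have "{p \<in> A. x p < b} = {p \<in> A. x p < a} \<union> {p \<in> A. a \<le> x p \<and> x p < b}" using that by auto
    moreover have "finite {p \<in> A. x p < b}" by (rule has_density_finite[OF d])
    ultimately have "card {p \<in> A. x p < b} = card {p \<in> A. x p < a} + card {p \<in> A. a \<le> x p \<and> x p < b}"
      by (metis (no_types, lifting) card_Un_disjoint disjoint_iff finite_Un leD mem_Collect_eq)
    then show ?thesis by (simp add: n_def)
  qed
  show ?thesis
  proof (intro exI[of _ "2 * D0"] allI impI conjI)
    show "0 \<le> 2 * D0" using D0nn by simp
  next
    fix a b :: real assume ab: "a \<le> b"
    show "real (card {p \<in> A. a \<le> x p \<and> x p < b}) \<le> \<rho> * (b - a) + \<delta> * \<bar>b\<bar> + 2 * D0"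
    proof (cases "b \<le> 0")
      case True
      moreover have "0 \<le> \<rho> * (b - a)" "0 \<le> \<delta> * \<bar>b\<bar>" using ab \<delta> \<open>\<rho> \<ge> 0\<close> by simp_all
      ultimately show ?thesis using diff[OF ab] n0[of a] n0[of b] ab D0nn by simp
    next
      case b: False
      define c where "c = max a 0"
      have c: "0 \<le> c" "a \<le> c" "c \<le> b" using ab b by (auto simp: c_def)
      have "\<delta> * c \<le> \<delta> * b" using c \<delta> by (intro mult_left_mono) auto
      moreover have "n a = n c" using n0[of a] n0[of 0] by (simp add: c_def max_def)
      moreover have "\<rho> * a \<le> \<rho> * c" using \<open>\<rho> \<ge> 0\<close> c by (intro mult_left_mono) auto
      ultimately show ?thesis using diff[OF ab] D0[of b] D0[of c] b c
        by (simp add: algebra_simps)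
    qed
  next
    fix a b :: real assume ab: "a \<le> b" and a: "0 \<le> a"
    have "\<delta> * a \<le> \<delta> * b" using ab \<delta> by (intro mult_left_mono) auto
    then show "\<rho> * (b - a) - \<delta> * b - 2 * D0 \<le> real (card {p \<in> A. a \<le> x p \<and> x p < b})"
      using diff[OF ab] D0[of b] D0[of a] a ab by (simp add: algebra_simps)
  qed
qed

section \<open>Balance of fluxes\<close>

text \<open>
  The number of particles per unit of time that a front with velocity \<open>w\<close> overtakes if it has
  particles of types \<open>1, \<dots>, n\<close> with velocities \<open>v k\<close> and densities \<open>r k\<close> on its right. The
  flux of the minus particles into a front with velocity \<open>w\<close> is obtained by reflection, as
  \<open>flux L (\<lambda>i. - vm i) rm (- w)\<close>.
\<close>

definition flux :: "nat \<Rightarrow> (nat \<Rightarrow> real) \<Rightarrow> (nat \<Rightarrow> real) \<Rightarrow> real \<Rightarrow> real" where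
  "flux n v r w = (\<Sum>k = 1..n. r k * max 0 (w - v k))"

lemma flux_mono:
  assumes "\<And>k. k \<in> {1..n} \<Longrightarrow> 0 < r k" and "w \<le> w'"
  shows "flux n v r w \<le> flux n v r w'"
  unfolding flux_def using assms by (intro sum_mono mult_left_mono) (auto simp: less_imp_le)

lemma flux_strict_mono:
  assumes r: "\<And>k. k \<in> {1..n} \<Longrightarrow> 0 < r k" and pos: "0 < flux n v r w" and "w < w'"
  shows "flux n v r w < flux n v r w'"
proof -
  obtain k where k: "k \<in> {1..n}" "r k * max 0 (w - v k) > 0"
    using pos sum_nonpos[of "{1..n}" "\<lambda>k. r k * max 0 (w - v k)"]
    unfolding flux_def by (meson not_less)
  have "v k < w"
  proof (rule ccontr)
    assume "\<not> v k < w"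
    then have "max 0 (w - v k) = 0" by simp
    with k(2) show False by simp
  qed
  then have "r k * max 0 (w - v k) < r k * max 0 (w' - v k)"
    using r[OF k(1)] \<open>w < w'\<close> by (intro mult_strict_left_mono) auto
  moreover have "r j * max 0 (w - v j) \<le> r j * max 0 (w' - v j)" if "j \<in> {1..n}" for j
    using r[OF that] \<open>w < w'\<close> by (intro mult_left_mono) auto
  ultimately show ?thesis unfolding flux_def
    using k(1) by (intro sum_strict_mono_ex1) auto
qed

lemma ex_slower_than_front:
  assumes "0 < flux n v r w" "\<And>k. k \<in> {1..n} \<Longrightarrow> 0 < r k"
  obtains k where "k \<in> {1..n}" "v k < w"
proof -
  have "\<exists>k\<in>{1..n}. v k < w"
  proof (rule ccontr)
    assume "\<not> ?thesis"
    then have "flux n v r w = 0" unfolding flux_def by (intro sum.neutral) auto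
    with assms show False by simp
  qed
  then show ?thesis using that by blast
qed

text \<open>
  If \<open>Jm\<close> and \<open>Jp\<close> are the types that a front with velocity \<open>u\<close> meets, then the net flux at
  \<open>u\<close> is \<open>V - u\<close> times the total density of these types. Types with velocity exactly \<open>u\<close> may
  be counted on either side.
\<close>

lemma V_minus_flux:
  assumes Jm: "Jm \<subseteq> {1..L}" "\<And>i. i \<in> Jm \<Longrightarrow> u \<le> vm i" "\<And>i. i \<in> {1..L} - Jm \<Longrightarrow> vm i \<le> u"
    and Jp: "Jp \<subseteq> {1..K}" "\<And>k. k \<in> Jp \<Longrightarrow> vp k \<le> u" "\<And>k. k \<in> {1..K} - Jp \<Longrightarrow> u \<le> vp k"
    and nz: "sum rm Jm + sum rp Jp \<noteq> 0"
  shows "(V vm rm vp rp Jm Jp - u) * (sum rm Jm + sum rp Jp) =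
    flux L (\<lambda>i. - vm i) rm (- u) - flux K vp rp u"
proof -
  have "flux L (\<lambda>i. - vm i) rm (- u) = (\<Sum>i\<in>Jm. rm i * max 0 (vm i - u))"
    unfolding flux_def using Jm(1) by (intro sum.mono_neutral_cong_right) (use Jm(3) in force)+
  also have "\<dots> = (\<Sum>i\<in>Jm. vm i * rm i - u * rm i)"
    using Jm(2) by (intro sum.cong) (auto simp: algebra_simps)
  finally have m: "flux L (\<lambda>i. - vm i) rm (- u) = (\<Sum>i\<in>Jm. vm i * rm i) - u * sum rm Jm"
    by (simp add: sum_subtractf sum_distrib_left)
  have "flux K vp rp u = (\<Sum>k\<in>Jp. rp k * max 0 (u - vp k))"
    unfolding flux_def using Jp(1) by (intro sum.mono_neutral_right) (use Jp(3) in force)+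
  also have "\<dots> = (\<Sum>k\<in>Jp. u * rp k - vp k * rp k)"
    using Jp(2) by (intro sum.cong) (auto simp: algebra_simps)
  finally have p: "flux K vp rp u = u * sum rp Jp - (\<Sum>k\<in>Jp. vp k * rp k)"
    by (simp add: sum_subtractf sum_distrib_left)
  have "V vm rm vp rp Jm Jp * (sum rm Jm + sum rp Jp) =
      (\<Sum>i\<in>Jm. vm i * rm i) + (\<Sum>k\<in>Jp. vp k * rp k)"
    using nz by (simp add: V_def)
  then show ?thesis by (simp add: m p algebra_simps)
qed

text \<open>
  The net flux \<open>g\<close> is decreasing with a unique zero \<open>w\<close> between the extreme velocities. For
  \<open>u = vm l\<close> a front meets all plus types and the minus types up to \<open>l\<close>, so the condition that
  defines \<open>L1\<close> reads \<open>g (vm l) < 0\<close>, that is, \<open>w < vm l\<close>. Thus \<open>{1..L1}\<close> and, by the same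
  argument, \<open>{1..K1}\<close> are the types that a front with velocity \<open>w\<close> meets, and \<open>W = w\<close>.
\<close>

lemma balance_velocity:
  fixes vp vm rp rm :: "nat \<Rightarrow> real"
  assumes K: "K \<ge> 1" and L: "L \<ge> 1"
    and vp: "strict_mono_on {1..K} vp" "\<And>k. k \<in> {1..K} \<Longrightarrow> vp k < 0"
    and vm: "strict_antimono_on {1..L} vm" "\<And>i. i \<in> {1..L} \<Longrightarrow> vm i > 0"
    and rp: "\<And>k. k \<in> {1..K} \<Longrightarrow> 0 < rp k" and rm: "\<And>i. i \<in> {1..L} \<Longrightarrow> 0 < rm i"
    and L1: "L1 = Max {l \<in> {1..L}. vm l > V vm rm vp rp {1..l} {1..K}}"
    and K1: "K1 = Max {k \<in> {1..K}. vp k < V vm rm vp rp {1..L} {1..k}}"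
    and W: "W = V vm rm vp rp {1..L1} {1..K1}"
  shows "flux K vp rp W = flux L (\<lambda>i. - vm i) rm (- W)" and "0 < flux K vp rp W"
proof -
  define g where "g u = flux L (\<lambda>i. - vm i) rm (- u) - flux K vp rp u" for u
  have vp_le: "vp j \<le> vp k" if "j \<in> {1..K}" "k \<in> {1..K}" "j \<le> k" for j k
    using strict_mono_on_leD[OF vp(1)] that by blast
  have vm_le: "vm k \<le> vm j" if "j \<in> {1..L}" "k \<in> {1..L}" "j \<le> k" for j k
    using monotone_onD[OF vm(1) that(1,2)] that(3) by (cases "j = k") auto
  have 1: "1 \<in> {1..K}" "1 \<in> {1..L}" using K L by auto
  have lt: "vp k < vm i" if "k \<in> {1..K}" "i \<in> {1..L}" for k i
    using vp(2)[OF that(1)] vm(2)[OF that(2)] by simp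
  have fp_pos: "0 < flux K vp rp u" if "vp 1 < u" for u
    unfolding flux_def using rp that 1 by (intro sum_pos2[of _ 1]) (auto simp: less_imp_le)
  have fm_pos: "0 < flux L (\<lambda>i. - vm i) rm (- u)" if "u < vm 1" for u
    unfolding flux_def using rm that 1 by (intro sum_pos2[of _ 1]) (auto simp: less_imp_le)
  have fp0: "flux K vp rp (vp 1) = 0"
    unfolding flux_def using vp_le[OF 1(1)] by (intro sum.neutral) auto
  have fm0: "flux L (\<lambda>i. - vm i) rm (- vm 1) = 0"
    unfolding flux_def using vm_le[OF 1(2)] by (intro sum.neutral) auto
  have ends: "0 < g (vp 1)" "g (vm 1) < 0"
    using fp_pos[of "vm 1"] fm_pos[of "vp 1"] fp0 fm0 lt[OF 1] by (simp_all add: g_def)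
  have "continuous_on {vp 1..vm 1} g"
    unfolding g_def flux_def by (intro continuous_intros)
  then obtain w where w: "vp 1 \<le> w" "w \<le> vm 1" "g w = 0"
    using IVT2'[of g "vm 1" 0 "vp 1"] ends lt[OF 1] by auto
  have "w \<noteq> vp 1" "w \<noteq> vm 1" using w ends by auto
  then have fw: "0 < flux K vp rp w" "0 < flux L (\<lambda>i. - vm i) rm (- w)"
    using w fp_pos fm_pos by auto
  have above: "g u < 0" if "w < u" for u
    using flux_strict_mono[OF rp fw(1) that] flux_mono[of L rm "- u" "- w" "\<lambda>i. - vm i"] rm that w(3)
    by (simp add: g_def)
  have below: "0 < g u" if "u < w" for u
    using flux_strict_mono[OF rm fw(2), of "- u"] flux_mono[of K rp u w vp] rp that w(3)
    by (simp add: g_def)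
  have g_sign: "g u < 0 \<longleftrightarrow> w < u" "0 < g u \<longleftrightarrow> u < w" for u
    using above[of u] below[of u] w(3) by (cases u w rule: linorder_cases; force)+
  have den: "0 < sum rm {1..l} + sum rp {1..k}" if "l \<le> L" "k \<le> K" "1 \<le> l" for l k
    using that rp rm by (intro add_pos_nonneg sum_pos sum_nonneg) (auto simp: less_imp_le)
  have "vm l > V vm rm vp rp {1..l} {1..K} \<longleftrightarrow> w < vm l" if l: "l \<in> {1..L}" for l
  proof -
    have d: "0 < sum rm {1..l} + sum rp {1..K}" using den l by auto
    have "(V vm rm vp rp {1..l} {1..K} - vm l) * (sum rm {1..l} + sum rp {1..K}) = g (vm l)"
      unfolding g_def using l vm_le lt d by (intro V_minus_flux) (auto simp: less_imp_le)
    then have "g (vm l) < 0 \<longleftrightarrow> V vm rm vp rp {1..l} {1..K} - vm l < 0"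
      using d by (metis mult_less_0_iff order_less_asym)
    then show ?thesis using g_sign by simp
  qed
  then have setL: "{l \<in> {1..L}. vm l > V vm rm vp rp {1..l} {1..K}} = {l \<in> {1..L}. w < vm l}" by blast
  have "vp k < V vm rm vp rp {1..L} {1..k} \<longleftrightarrow> vp k < w" if k: "k \<in> {1..K}" for k
  proof -
    have d: "0 < sum rm {1..L} + sum rp {1..k}" using den k L by auto
    have "(V vm rm vp rp {1..L} {1..k} - vp k) * (sum rm {1..L} + sum rp {1..k}) = g (vp k)"
      unfolding g_def using k vp_le lt d by (intro V_minus_flux) (auto simp: less_imp_le)
    then have "0 < g (vp k) \<longleftrightarrow> 0 < V vm rm vp rp {1..L} {1..k} - vp k"
      using d by (metis zero_less_mult_iff order_less_asym)
    then show ?thesis using g_sign by simp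
  qed
  then have setK: "{k \<in> {1..K}. vp k < V vm rm vp rp {1..L} {1..k}} = {k \<in> {1..K}. vp k < w}" by blast
  have "1 \<in> {l \<in> {1..L}. w < vm l}" "1 \<in> {k \<in> {1..K}. vp k < w}"
    using 1 w \<open>w \<noteq> vp 1\<close> \<open>w \<noteq> vm 1\<close> by auto
  then have ne: "{l \<in> {1..L}. w < vm l} \<noteq> {}" "{k \<in> {1..K}. vp k < w} \<noteq> {}" by blast+
  have "L1 \<in> {l \<in> {1..L}. w < vm l}" "K1 \<in> {k \<in> {1..K}. vp k < w}"
    unfolding L1 K1 setL setK by (rule Max_in[OF _ ne(1)], simp, rule Max_in[OF _ ne(2)], simp)
  then have L1': "L1 \<in> {1..L}" "w < vm L1" and K1': "K1 \<in> {1..K}" "vp K1 < w" by auto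
  have L1_max: "l \<le> L1" if "l \<in> {1..L}" "w < vm l" for l
    unfolding L1 setL using that by (intro Max_ge) auto
  have K1_max: "k \<le> K1" if "k \<in> {1..K}" "vp k < w" for k
    unfolding K1 setK using that by (intro Max_ge) auto
  have d: "0 < sum rm {1..L1} + sum rp {1..K1}" using den L1' K1' by auto
  have "(W - w) * (sum rm {1..L1} + sum rp {1..K1}) = g w"
    unfolding g_def W
  proof (rule V_minus_flux)
    show "{1..L1} \<subseteq> {1..L}" "{1..K1} \<subseteq> {1..K}" using L1' K1' by auto
    show "w \<le> vm i" if "i \<in> {1..L1}" for i using vm_le[of i L1] that L1' by auto
    show "vp k \<le> w" if "k \<in> {1..K1}" for k using vp_le[of k K1] that K1' by auto
    show "vm i \<le> w" if "i \<in> {1..L} - {1..L1}" for i using L1_max[of i] that by force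
    show "w \<le> vp k" if "k \<in> {1..K} - {1..K1}" for k using K1_max[of k] that by force
    show "sum rm {1..L1} + sum rp {1..K1} \<noteq> 0" using d by simp
  qed
  then have "W = w" using d w(3) by simp
  then show "flux K vp rp W = flux L (\<lambda>i. - vm i) rm (- W)" "0 < flux K vp rp W"
    using w(3) fw by (simp_all add: g_def)
qed

section \<open>Collisions in a single realization\<close>

text \<open>
  The time at which a pair of freely moving particles meets, as a function of their initial
  distances \<open>x\<close> and \<open>y\<close> from the origin.
\<close>

definition meet ::
  "(nat \<Rightarrow> real) \<Rightarrow> (nat \<Rightarrow> real) \<Rightarrow> (particle \<Rightarrow> real) \<Rightarrow> (particle \<Rightarrow> real) \<Rightarrow>
   particle \<times> particle \<Rightarrow> real" where
  "meet vp vm x y c = (x (fst c) + y (snd c)) / (vm (snd (snd c)) - vp (snd (fst c)))"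

lemma card_by_type:
  assumes "finite Q" and "Q \<subseteq> particles n"
  shows "(\<Sum>k = 1..n. card {p \<in> Q. snd p = k}) = card Q"
proof -
  have "Q = (\<Union>k\<in>{1..n}. {p \<in> Q. snd p = k})" using assms(2) by (force simp: particles_def)
  moreover have "card (\<Union>k\<in>{1..n}. {p \<in> Q. snd p = k}) = (\<Sum>k = 1..n. card {p \<in> Q. snd p = k})"
    using assms(1) by (intro card_UN_disjoint) auto
  ultimately show ?thesis by simp
qed

text \<open>
  Particles with arbitrary initial distances \<open>x\<close> (to the right, plus) and \<open>y\<close> (to the left,
  minus) from the origin such that each type has an asymptotic density. The assumptions are
  invariant under reflection of the line, which exchanges the signs and negates the
  velocities.
\<close>

locale particle_field =
  fixes K L :: nat and vp vm rp rm :: "nat \<Rightarrow> real" and x y :: "particle \<Rightarrow> real"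
  assumes v_less: "\<And>k i. k \<in> {1..K} \<Longrightarrow> i \<in> {1..L} \<Longrightarrow> vp k < vm i"
    and x_pos: "\<And>p. p \<in> particles K \<Longrightarrow> 0 < x p"
    and y_pos: "\<And>q. q \<in> particles L \<Longrightarrow> 0 < y q"
    and rp_pos: "\<And>k. k \<in> {1..K} \<Longrightarrow> 0 < rp k"
    and rm_pos: "\<And>i. i \<in> {1..L} \<Longrightarrow> 0 < rm i"
    and x_density: "\<And>k. k \<in> {1..K} \<Longrightarrow> has_density (rp k) {p \<in> particles K. snd p = k} x"
    and y_density: "\<And>i. i \<in> {1..L} \<Longrightarrow> has_density (rm i) {q \<in> particles L. snd q = i} y"
begin

abbreviation "tau \<equiv> meet vp vm x y"

text \<open>
  The point at which the pair would meet in free motion.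
\<close>

definition place :: "particle \<times> particle \<Rightarrow> real" where
  "place c = x (fst c) + vp (snd (fst c)) * tau c"

lemma mirror: "particle_field L K (\<lambda>i. - vm i) (\<lambda>k. - vp k) rm rp y x"
  using v_less x_pos y_pos rp_pos rm_pos x_density y_density by unfold_locales auto

lemma type_in: "p \<in> particles n \<Longrightarrow> snd p \<in> {1..n}"
  by (auto simp: particles_def)

lemma v_less': "c \<in> particles K \<times> particles L \<Longrightarrow> vp (snd (fst c)) < vm (snd (snd c))"
  by (auto intro!: v_less simp: particles_def)

lemma tau_pos: "c \<in> particles K \<times> particles L \<Longrightarrow> 0 < tau c"
  using v_less'[of c] x_pos[of "fst c"] y_pos[of "snd c"] by (auto simp: meet_def)

lemma tau_less_iff:
  assumes "c \<in> particles K \<times> particles L"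
  shows "tau c < t \<longleftrightarrow>
    x (fst c) + vp (snd (fst c)) * t < - y (snd c) + vm (snd (snd c)) * t"
  using v_less'[OF assms] by (simp add: meet_def field_simps)

lemma place_minus:
  assumes "c \<in> particles K \<times> particles L"
  shows "place c = - y (snd c) + vm (snd (snd c)) * tau c"
  using v_less'[OF assms] by (simp add: place_def meet_def field_simps)

lemma finite_x: "finite {p \<in> particles K. x p < a}"
proof -
  have "finite {p \<in> {p \<in> particles K. snd p = k}. x p < a}" if "k \<in> {1..K}" for k
    by (rule has_density_finite[OF x_density[OF that]])
  moreover have "{p \<in> particles K. x p < a} =
      (\<Union>k\<in>{1..K}. {p \<in> {p \<in> particles K. snd p = k}. x p < a})"
    using type_in by blast
  ultimately show ?thesis by simp
qed

lemma x_uniform: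
  assumes "\<delta> > 0"
  shows "\<exists>D\<ge>0. \<forall>k\<in>{1..K}. \<forall>a b. a \<le> b \<longrightarrow>
    real (card {p \<in> particles K. snd p = k \<and> a \<le> x p \<and> x p < b}) \<le> rp k * (b - a) + \<delta> * \<bar>b\<bar> + D \<and>
    (0 \<le> a \<longrightarrow> rp k * (b - a) - \<delta> * b - D \<le>
      real (card {p \<in> particles K. snd p = k \<and> a \<le> x p \<and> x p < b}))"
proof -
  define P where "P k D a b \<longleftrightarrow>
    real (card {p \<in> particles K. snd p = k \<and> a \<le> x p \<and> x p < b}) \<le> rp k * (b - a) + \<delta> * \<bar>b\<bar> + D \<and>
    (0 \<le> a \<longrightarrow> rp k * (b - a) - \<delta> * b - D \<le>
      real (card {p \<in> particles K. snd p = k \<and> a \<le> x p \<and> x p < b}))" for k D a b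
  have "\<exists>D\<ge>0. \<forall>a b. a \<le> b \<longrightarrow> P k D a b" if "k \<in> {1..K}" for k
    unfolding P_def using has_density_interval[OF x_density[OF that] _ _ assms] rp_pos[OF that] x_pos
    by (simp add: less_imp_le conj_assoc)
  then have "\<forall>k\<in>{1..K}. \<exists>D. 0 \<le> D \<and> (\<forall>a b. a \<le> b \<longrightarrow> P k D a b)" by blast
  from bchoice[OF this] obtain D where
    D: "\<And>k. k \<in> {1..K} \<Longrightarrow> 0 \<le> D k" and
    DD: "\<And>k a b. k \<in> {1..K} \<Longrightarrow> a \<le> b \<Longrightarrow> P k (D k) a b" by blast
  have le: "D k \<le> sum D {1..K}" if "k \<in> {1..K}" for k
    using that D by (intro member_le_sum) auto
  show ?thesis
  proof (intro exI[of _ "sum D {1..K}"] conjI ballI allI impI)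
    show "0 \<le> sum D {1..K}" using D by (intro sum_nonneg) auto
    fix k and a b :: real assume *: "k \<in> {1..K}" "a \<le> b"
    show "real (card {p \<in> particles K. snd p = k \<and> a \<le> x p \<and> x p < b}) \<le>
        rp k * (b - a) + \<delta> * \<bar>b\<bar> + sum D {1..K}"
      using DD[OF *, unfolded P_def] le[OF *(1)] by linarith
    show "rp k * (b - a) - \<delta> * b - sum D {1..K} \<le>
        real (card {p \<in> particles K. snd p = k \<and> a \<le> x p \<and> x p < b})" if "0 \<le> a"
      using DD[OF *, unfolded P_def] le[OF *(1)] that by linarith
  qed
qed

lemma finite_early: "finite {c \<in> particles K \<times> particles L. tau c < t}"
proof -
  interpret m: particle_field L K "\<lambda>i. - vm i" "\<lambda>k. - vp k" rm rp y x by (rule mirror)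
  define R where "R = (\<Sum>i = 1..L. \<bar>vm i\<bar>) + (\<Sum>k = 1..K. \<bar>vp k\<bar>)"
  have "c \<in> {p \<in> particles K. x p < R * \<bar>t\<bar>} \<times> {q \<in> particles L. y q < R * \<bar>t\<bar>}"
    if c: "c \<in> particles K \<times> particles L" and "tau c < t" for c
  proof -
    have "\<bar>vm (snd (snd c))\<bar> \<le> (\<Sum>i = 1..L. \<bar>vm i\<bar>)"
      by (rule member_le_sum[where f="\<lambda>i. \<bar>vm i\<bar>"]) (use c in \<open>auto simp: particles_def\<close>)
    moreover have "\<bar>vp (snd (fst c))\<bar> \<le> (\<Sum>k = 1..K. \<bar>vp k\<bar>)"
      by (rule member_le_sum[where f="\<lambda>i. \<bar>vp i\<bar>"]) (use c in \<open>auto simp: particles_def\<close>)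
    ultimately have "\<bar>vm (snd (snd c)) - vp (snd (fst c))\<bar> \<le> R" by (simp add: R_def)
    then have "\<bar>vm (snd (snd c)) - vp (snd (fst c))\<bar> * \<bar>t\<bar> \<le> R * \<bar>t\<bar>" by (intro mult_right_mono) auto
    then have "(vm (snd (snd c)) - vp (snd (fst c))) * t \<le> R * \<bar>t\<bar>"
      by (metis abs_ge_self abs_mult order_trans)
    moreover have "x (fst c) + y (snd c) < (vm (snd (snd c)) - vp (snd (fst c))) * t"
      using tau_less_iff[OF c] \<open>tau c < t\<close> by (simp add: algebra_simps)
    moreover have "0 < x (fst c)" "0 < y (snd c)" using c x_pos y_pos by auto
    ultimately show ?thesis using c by auto
  qed
  then have "{c \<in> particles K \<times> particles L. tau c < t} \<subseteq>
      {p \<in> particles K. x p < R * \<bar>t\<bar>} \<times> {q \<in> particles L. y q < R * \<bar>t\<bar>}" by blast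
  then show ?thesis using finite_x m.finite_x by (meson finite_SigmaI finite_subset)
qed

end

text \<open>
  The dynamics of one realization in which no particle takes part in two collisions.
\<close>

locale annihilation = particle_field +
  fixes C :: "(particle \<times> particle) set"
  assumes C: "is_collision_set (particles K) (particles L) tau C"
    and inj_fst: "inj_on fst C" and inj_snd: "inj_on snd C"
begin

lemma C_in: "c \<in> C \<Longrightarrow> c \<in> particles K \<times> particles L"
  using C by (auto simp: is_collision_set_def)

lemma mirror_annihilation:
  "annihilation L K (\<lambda>i. - vm i) (\<lambda>k. - vp k) rm rp y x (prod.swap ` C)"
proof -
  interpret m: particle_field L K "\<lambda>i. - vm i" "\<lambda>k. - vp k" rm rp y x by (rule mirror)
  have tau: "m.tau (q, p) = tau (p, q)" for p q by (simp add: meet_def add.commute)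
  show ?thesis
  proof unfold_locales
    show "is_collision_set (particles L) (particles K) m.tau (prod.swap ` C)"
      unfolding is_collision_set_def
    proof (intro conjI ballI)
      show "prod.swap ` C \<subseteq> particles L \<times> particles K" using C_in by auto
      fix q p assume "q \<in> particles L" "p \<in> particles K"
      then have "(p, q) \<in> C \<longleftrightarrow>
          \<not> (\<exists>(p', q')\<in>C. (p' = p \<or> q' = q) \<and> tau (p', q') < tau (p, q))"
        using C by (simp add: is_collision_set_def)
      then show "(q, p) \<in> prod.swap ` C \<longleftrightarrow>
          \<not> (\<exists>(p', q')\<in>prod.swap ` C. (p' = q \<or> q' = p) \<and> m.tau (p', q') < m.tau (q, p))"
        by (auto simp: tau)
    qed
    show "inj_on fst (prod.swap ` C)" "inj_on snd (prod.swap ` C)"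
      using inj_fst inj_snd by (auto simp: inj_on_def)
  qed
qed

lemma collision_unique:
  assumes "c \<in> C" "c' \<in> C" "fst c = fst c' \<or> snd c = snd c'"
  shows "c = c'"
  using assms inj_fst inj_snd by (auto dest: inj_onD)

text \<open>
  Particles of opposite sign do not pass each other.
\<close>

lemma dead_if_crossed:
  assumes "p \<in> particles K" "q \<in> particles L" "tau (p, q) < t"
  shows "\<exists>c\<in>C. (fst c = p \<or> snd c = q) \<and> tau c < t"
proof (cases "(p, q) \<in> C")
  case True
  with assms show ?thesis by force
next
  case False
  then obtain p' q' where "(p', q') \<in> C" "p' = p \<or> q' = q" "tau (p', q') < tau (p, q)"
    using C assms(1,2) by (fastforce simp: is_collision_set_def)
  then show ?thesis using assms(3) by (intro bexI[of _ "(p', q')"]) auto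
qed

text \<open>
  The minus particle of the collision \<open>c\<close> started to the left of all plus particles and was
  alive until \<open>c\<close>. A plus particle whose free motion leads to the left of \<open>c\<close> would have met
  it before, and so must have disappeared earlier.
\<close>

lemma dead_left_of_collision:
  assumes c: "c \<in> C" and p: "p \<in> particles K" and left: "x p + vp (snd p) * tau c < place c"
  shows "\<exists>c'\<in>C. fst c' = p \<and> tau c' < tau c"
proof -
  note cin = C_in[OF c]
  have "(p, snd c) \<in> particles K \<times> particles L" using p cin by auto
  then have "tau (p, snd c) < tau c"
    using left place_minus[OF cin] by (simp add: tau_less_iff)
  then obtain c' where c': "c' \<in> C" "fst c' = p \<or> snd c' = snd c" "tau c' < tau c"
    using dead_if_crossed[of p "snd c"] p cin by (metis mem_Sigma_iff prod.collapse)
  then show ?thesis using collision_unique[OF c c'(1)] by auto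
qed

lemma dead_right_of_collision:
  assumes c: "c \<in> C" and q: "q \<in> particles L" and right: "place c < - y q + vm (snd q) * tau c"
  shows "\<exists>c'\<in>C. snd c' = q \<and> tau c' < tau c"
proof -
  note cin = C_in[OF c]
  have "(fst c, q) \<in> particles K \<times> particles L" using q cin by auto
  then have "tau (fst c, q) < tau c"
    using right by (simp add: tau_less_iff place_def)
  then obtain c' where c': "c' \<in> C" "fst c' = fst c \<or> snd c' = q" "tau c' < tau c"
    using dead_if_crossed[of "fst c" q] q cin by (metis mem_Sigma_iff prod.collapse)
  then show ?thesis using collision_unique[OF c c'(1)] by auto
qed

lemma finite_C: "finite {c \<in> C. tau c < t}"
  by (rule finite_subset[OF _ finite_early[of t]]) (use C_in in auto)

lemma ex_first:
  assumes "S \<subseteq> C" "S \<noteq> {}"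
  shows "\<exists>c\<in>S. \<forall>c'\<in>S. tau c \<le> tau c'"
proof -
  obtain c0 where c0: "c0 \<in> S" using assms by auto
  define F where "F = {c \<in> S. tau c < tau c0 + 1}"
  have "finite F"
    by (rule finite_subset[OF _ finite_C[of "tau c0 + 1"]]) (use assms in \<open>auto simp: F_def\<close>)
  moreover have "c0 \<in> F" using c0 by (simp add: F_def)
  ultimately have F: "finite F" "F \<noteq> {}" by blast+
  then obtain c where c: "c \<in> F" "tau c = Min (tau ` F)"
    using Min_in[of "tau ` F"] by (metis (no_types, lifting) finite_imageI image_iff image_is_empty)
  have "tau c \<le> tau c'" if "c' \<in> S" for c'
  proof (cases "c' \<in> F")
    case True
    with c F show ?thesis by simp
  next
    case False
    with c that show ?thesis by (simp add: F_def)
  qed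
  with c(1) show ?thesis unfolding F_def by blast
qed

end

section \<open>Linear barriers for the collisions\<close>

context annihilation
begin

text \<open>
  Suppose that \<open>c\<close> is a first collision on or beyond the moving barrier \<open>w * t + b\<close>. Plus
  particles that the barrier overtakes in free motion between \<open>s\<close> and \<open>tau c\<close> are then killed
  between these times: not earlier since all earlier collisions are below the barrier, and not
  later since \<open>c\<close> occurs to their right.
\<close>

lemma swept_plus:
  assumes "\<And>c. c \<in> C \<Longrightarrow> tau c < u \<Longrightarrow> place c < w * tau c + b" and "0 \<le> s" and "s \<le> u" and "0 \<le> b"
    and c: "c \<in> C" "tau c = u" "w * u + b \<le> place c"
    and p: "p \<in> particles K" "(w - vp (snd p)) * s + b \<le> x p" "x p < (w - vp (snd p)) * u + b"
  shows "p \<in> fst ` {c \<in> C. s < tau c \<and> tau c < u}"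
proof -
  have lt: "vp (snd p) < w"
  proof (rule ccontr)
    assume "\<not> vp (snd p) < w"
    then have "(w - vp (snd p)) * u \<le> (w - vp (snd p)) * s"
      using \<open>s \<le> u\<close> by (intro mult_left_mono_neg) auto
    with p show False by simp
  qed
  have "x p + vp (snd p) * tau c < place c" using c p(3) by (simp add: algebra_simps)
  then obtain c' where c': "c' \<in> C" "fst c' = p" "tau c' < tau c"
    using dead_left_of_collision[OF c(1) p(1)] by blast
  have "\<not> tau c' \<le> s"
  proof
    assume le: "tau c' \<le> s"
    have "place c' < w * tau c' + b" using assms(1) c' c by auto
    then have "x p < (w - vp (snd p)) * tau c' + b" using c'(2) by (simp add: place_def algebra_simps)
    also have "\<dots> \<le> (w - vp (snd p)) * s + b" using le lt by (intro add_right_mono mult_left_mono) auto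
    finally show False using p(2) by simp
  qed
  then show ?thesis using c' c by force
qed

lemma count_plus:
  assumes "\<And>c. c \<in> C \<Longrightarrow> tau c < u \<Longrightarrow> place c < w * tau c + b" and "0 \<le> s" and "s \<le> u" and "0 \<le> b"
    and c: "c \<in> C" "tau c = u" "w * u + b \<le> place c"
    and k: "k \<in> {1..K}" and R: "w - vp k \<le> R" "1 \<le> R" and "\<delta> > 0" "0 \<le> D"
    and D: "\<And>a b. 0 \<le> a \<Longrightarrow> a \<le> b \<Longrightarrow> rp k * (b - a) - \<delta> * b - D \<le>
      real (card {p \<in> particles K. snd p = k \<and> a \<le> x p \<and> x p < b})"
  shows "rp k * max 0 (w - vp k) * (u - s) - (\<delta> * (R * (u + b)) + D) \<le>
     real (card {p \<in> fst ` {c \<in> C. s < tau c \<and> tau c < u}. snd p = k})"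
    (is "_ \<le> real (card ?N)")
proof (cases "vp k < w")
  case False
  then have "max 0 (w - vp k) = 0" by simp
  moreover have "0 \<le> \<delta> * (R * (u + b))" using assms by simp
  moreover have "(0::real) \<le> real (card ?N)" by simp
  ultimately show ?thesis using \<open>0 \<le> D\<close> by (simp del: of_nat_0_le_iff)
next
  case True
  define a0 where "a0 = (w - vp k) * s + b"
  define b0 where "b0 = (w - vp k) * u + b"
  have ab: "0 \<le> a0" "a0 \<le> b0" using assms True by (auto simp: a0_def b0_def intro!: mult_left_mono)
  have "(w - vp k) * u \<le> R * u" using R assms by (intro mult_right_mono) auto
  moreover have "1 * b \<le> R * b" using R assms by (intro mult_right_mono) auto
  ultimately have "b0 \<le> R * (u + b)" by (simp add: b0_def algebra_simps)
  then have "\<delta> * b0 \<le> \<delta> * (R * (u + b))" using \<open>\<delta> > 0\<close> by simp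
  moreover have "rp k * max 0 (w - vp k) * (u - s) = rp k * (b0 - a0)"
    using True by (simp add: a0_def b0_def algebra_simps)
  moreover have "real (card {p \<in> particles K. snd p = k \<and> a0 \<le> x p \<and> x p < b0}) \<le> real (card ?N)"
  proof -
    have "{p \<in> particles K. snd p = k \<and> a0 \<le> x p \<and> x p < b0} \<subseteq> ?N"
      using swept_plus[OF assms(1-4) c] unfolding a0_def b0_def by blast
    moreover have "finite ?N"
    proof -
      have "finite {c \<in> C. s < tau c \<and> tau c < u}" by (rule finite_subset[OF _ finite_C[of u]]) blast
      then show ?thesis by simp
    qed
    ultimately show ?thesis by (simp add: card_mono)
  qed
  ultimately show ?thesis using D[OF ab] by linarith
qed

text \<open>
  If the minus particles that collide after time \<open>s\<close> are at this time not beyond the moving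
  barrier \<open>w * t + b\<close>, and all collisions between \<open>s\<close> and \<open>u\<close> are beyond it, then the minus
  particles killed in between have crossed the barrier, and their number is at most the flux
  through it, up to the counting error.
\<close>

lemma count_minus:
  assumes "0 \<le> s" and "s \<le> u" and "0 \<le> b"
    and after: "\<And>c. c \<in> C \<Longrightarrow> s < tau c \<Longrightarrow> tau c < u \<Longrightarrow> w * tau c + b < place c"
    and surv: "\<And>c. c \<in> C \<Longrightarrow> s < tau c \<Longrightarrow> - y (snd c) + vm (snd (snd c)) * s \<le> w * s + b"
    and i: "i \<in> {1..L}" and R: "\<bar>vm i - w\<bar> \<le> R" "1 \<le> R" and "\<delta> > 0" "0 \<le> D"
    and D: "\<And>a b. a \<le> b \<Longrightarrow>
      real (card {q \<in> particles L. snd q = i \<and> a \<le> y q \<and> y q < b}) \<le> rm i * (b - a) + \<delta> * \<bar>b\<bar> + D"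
  shows "real (card {q \<in> snd ` {c \<in> C. s < tau c \<and> tau c < u}. snd q = i}) \<le>
      rm i * max 0 (vm i - w) * (u - s) + (\<delta> * (R * (u + b)) + D)"
    (is "real (card ?N) \<le> _")
proof -
  have N: "q \<in> particles L \<and> 0 < y q \<and> snd q = i \<and> (vm i - w) * s - b \<le> y q \<and>
      w < vm i \<and> y q < (vm i - w) * u - b" if qN: "q \<in> ?N" for q
  proof -
    obtain c where c: "c \<in> C" "s < tau c" "tau c < u" "snd c = q" and q: "snd q = i"
      using qN by blast
    note cin = C_in[OF c(1)]
    have q': "q \<in> particles L" using cin c(4) by auto
    have "w * tau c + b < - y q + vm i * tau c"
      using after[OF c(1-3)] place_minus[OF cin] c(4) q by simp
    then have *: "y q < (vm i - w) * tau c - b" by (simp add: algebra_simps)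
    have lt: "w < vm i"
    proof (rule ccontr)
      assume "\<not> w < vm i"
      then have "(vm i - w) * tau c \<le> 0" using tau_pos[OF cin] by (simp add: mult_le_0_iff)
      with * y_pos[OF q'] \<open>0 \<le> b\<close> show False by linarith
    qed
    have "(vm i - w) * tau c \<le> (vm i - w) * u" using c(3) lt by (intro mult_left_mono) auto
    with * have "y q < (vm i - w) * u - b" by linarith
    moreover have "(vm i - w) * s - b \<le> y q" using surv[OF c(1,2)] c(4) q by (simp add: algebra_simps)
    ultimately show ?thesis using lt q' q y_pos[OF q'] by auto
  qed
  have rhs: "0 \<le> \<delta> * (R * (u + b)) + D" using assms by simp
  show ?thesis
  proof (cases "w < vm i")
    case False
    then have "?N = {}" using N by blast
    then have "card ?N = 0" by (metis card.empty)
    moreover have "max 0 (vm i - w) = 0" using False by simp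
    ultimately show ?thesis using rhs by simp
  next
    case True
    define a0 where "a0 = (vm i - w) * s - b"
    define b0 where "b0 = (vm i - w) * u - b"
    have ab: "a0 \<le> b0" using assms True by (auto simp: a0_def b0_def intro!: mult_left_mono)
    have "0 \<le> (vm i - w) * u" using True assms by simp
    moreover have "(vm i - w) * u \<le> R * u" using R assms by (intro mult_right_mono) auto
    moreover have "1 * b \<le> R * b" using R assms by (intro mult_right_mono) auto
    moreover have "0 \<le> R * u" using R assms by simp
    ultimately have "\<bar>b0\<bar> \<le> R * (u + b)" using \<open>0 \<le> b\<close> unfolding b0_def distrib_left by linarith
    then have "\<delta> * \<bar>b0\<bar> \<le> \<delta> * (R * (u + b))" using \<open>\<delta> > 0\<close> by simp
    moreover have "rm i * max 0 (vm i - w) * (u - s) = rm i * (b0 - a0)"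
      using True by (simp add: a0_def b0_def algebra_simps)
    moreover have "real (card ?N) \<le> real (card {q \<in> particles L. snd q = i \<and> a0 \<le> y q \<and> y q < b0})"
    proof -
      interpret m: particle_field L K "\<lambda>i. - vm i" "\<lambda>k. - vp k" rm rp y x by (rule mirror)
      have "?N \<subseteq> {q \<in> particles L. snd q = i \<and> a0 \<le> y q \<and> y q < b0}"
        using N unfolding a0_def b0_def by blast
      moreover have "finite {q \<in> particles L. snd q = i \<and> a0 \<le> y q \<and> y q < b0}"
        by (rule finite_subset[OF _ m.finite_x[of b0]]) blast
      ultimately show ?thesis by (simp add: card_mono)
    qed
    ultimately show ?thesis using D[OF ab] by linarith
  qed
qed

text \<open>
  The time \<open>s\<close> is that of the last collision before \<open>u\<close> on or below the barrier, or \<open>0\<close> if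
  there is none. Minus particles that survive this collision are not to the right of it.
\<close>

lemma ex_last_before:
  assumes "0 < u" and "0 \<le> b"
  shows "\<exists>s. 0 \<le> s \<and> s < u \<and>
     (\<forall>c\<in>C. s < tau c \<longrightarrow> tau c < u \<longrightarrow> w * tau c + b < place c) \<and>
     (\<forall>c\<in>C. s < tau c \<longrightarrow> - y (snd c) + vm (snd (snd c)) * s \<le> w * s + b)"
proof -
  define G where "G = {c \<in> C. tau c < u \<and> place c \<le> w * tau c + b}"
  have finG: "finite G" by (rule finite_subset[OF _ finite_C[of u]]) (auto simp: G_def)
  show ?thesis
  proof (cases "G = {}")
    case True
    have "w * tau c + b < place c" if "c \<in> C" "tau c < u" for c
      using True that unfolding G_def by (metis (mono_tags, lifting) empty_Collect_eq not_less)
    moreover have "0 < y (snd c)" if "c \<in> C" for c using C_in[OF that] y_pos by auto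
    ultimately show ?thesis using assms by (intro exI[of _ 0]) force
  next
    case False
    then have "Max (tau ` G) \<in> tau ` G" using finG by (intro Max_in) auto
    then obtain c0 where c0: "c0 \<in> G" "tau c0 = Max (tau ` G)" by (metis imageE)
    have max: "tau c \<le> tau c0" if "c \<in> G" for c using that finG c0(2) by simp
    have c0': "c0 \<in> C" "tau c0 < u" "place c0 \<le> w * tau c0 + b" using c0(1) by (simp_all add: G_def)
    show ?thesis
    proof (intro exI[of _ "tau c0"] conjI ballI impI)
      show "0 \<le> tau c0" using tau_pos[OF C_in[OF c0'(1)]] by simp
      show "tau c0 < u" by fact
      show "w * tau c + b < place c" if "c \<in> C" "tau c0 < tau c" "tau c < u" for c
        using max[of c] that unfolding G_def by force
      show "- y (snd c) + vm (snd (snd c)) * tau c0 \<le> w * tau c0 + b" if c: "c \<in> C" "tau c0 < tau c" for c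
      proof (rule ccontr)
        assume "\<not> ?thesis"
        then have right: "place c0 < - y (snd c) + vm (snd (snd c)) * tau c0" using c0'(3) by linarith
        have q: "snd c \<in> particles L" using C_in[OF c(1)] by auto
        obtain c' where "c' \<in> C" "snd c' = snd c" "tau c' < tau c0"
          using dead_right_of_collision[OF c0'(1) q right] by blast
        then show False using collision_unique[OF c(1)] c(2) by (metis less_asym)
      qed
    qed
  qed
qed

lemma velocity_bound:
  obtains R where "1 \<le> R" "\<And>k. k \<in> {1..K} \<Longrightarrow> \<bar>vp k\<bar> \<le> R" "\<And>i. i \<in> {1..L} \<Longrightarrow> \<bar>vm i\<bar> \<le> R"
proof
  have nn: "0 \<le> (\<Sum>k = 1..K. \<bar>vp k\<bar>)" "0 \<le> (\<Sum>i = 1..L. \<bar>vm i\<bar>)" by (simp_all add: sum_nonneg)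
  show "1 \<le> 1 + (\<Sum>k = 1..K. \<bar>vp k\<bar>) + (\<Sum>i = 1..L. \<bar>vm i\<bar>)" using nn by simp
  show "\<bar>vp k\<bar> \<le> 1 + (\<Sum>k = 1..K. \<bar>vp k\<bar>) + (\<Sum>i = 1..L. \<bar>vm i\<bar>)" if "k \<in> {1..K}" for k
  proof -
    have "\<bar>vp k\<bar> \<le> (\<Sum>k = 1..K. \<bar>vp k\<bar>)"
      by (rule member_le_sum[where f="\<lambda>k. \<bar>vp k\<bar>"]) (use that in auto)
    then show ?thesis using nn by linarith
  qed
  show "\<bar>vm k\<bar> \<le> 1 + (\<Sum>k = 1..K. \<bar>vp k\<bar>) + (\<Sum>i = 1..L. \<bar>vm i\<bar>)" if "k \<in> {1..L}" for k
  proof -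
    have "\<bar>vm k\<bar> \<le> (\<Sum>k = 1..L. \<bar>vm k\<bar>)"
      by (rule member_le_sum[where f="\<lambda>k. \<bar>vm k\<bar>"]) (use that in auto)
    then show ?thesis using nn by linarith
  qed
qed

text \<open>
  Suppose that some collision is on or above the steep barrier with velocity \<open>W + 2 * \<theta>\<close> and
  offset \<open>B\<close>. Let \<open>u\<close> be the first time of such a collision, and \<open>s < u\<close> the last time before
  \<open>u\<close> of a collision on or below the flat barrier with velocity \<open>W + \<theta>\<close> and offset \<open>B / 2\<close>.
  Collisions between \<open>s\<close> and \<open>u\<close> kill equally many particles of either sign, but at least as
  many plus particles as the steep barrier overtakes and at most as many minus particles as
  cross the flat barrier. As the balance at \<open>W\<close> is tipped by \<open>\<kappa> > 0\<close>, this bounds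
  \<open>\<kappa> * (u - s)\<close> by the counting error, which is a small fraction of \<open>u + B\<close> if \<open>B\<close> is large.
  On the other hand, the collision at time \<open>u\<close> involves a minus particle that was not beyond
  the flat barrier at time \<open>s\<close>. Its velocity is bounded, so \<open>u - s\<close> is at least of order
  \<open>u + B\<close>.
\<close>

lemma upper_barrier:
  assumes bal: "flux K vp rp W = flux L (\<lambda>i. - vm i) rm (- W)" and pos: "0 < flux K vp rp W"
    and \<epsilon>: "0 < \<epsilon>"
  shows "\<exists>B\<ge>0. \<forall>c\<in>C. place c < (W + \<epsilon>) * tau c + B"
proof -
  define \<theta> where "\<theta> = min (\<epsilon> / 2) (1 / 2)"
  have \<theta>: "0 < \<theta>" "2 * \<theta> \<le> \<epsilon>" "\<theta> \<le> 1 / 2" using \<epsilon> by (auto simp: \<theta>_def)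
  define \<kappa> where "\<kappa> = flux K vp rp (W + 2 * \<theta>) - flux L (\<lambda>i. - vm i) rm (- (W + \<theta>))"
  have "flux K vp rp W < flux K vp rp (W + 2 * \<theta>)"
    using rp_pos pos \<theta> by (intro flux_strict_mono) auto
  moreover have "flux L (\<lambda>i. - vm i) rm (- (W + \<theta>)) \<le> flux L (\<lambda>i. - vm i) rm (- W)"
    using rm_pos \<theta> by (intro flux_mono) auto
  ultimately have \<kappa>: "0 < \<kappa>" using bal by (simp add: \<kappa>_def)
  obtain R0 where R0: "1 \<le> R0" "\<And>k. k \<in> {1..K} \<Longrightarrow> \<bar>vp k\<bar> \<le> R0" "\<And>i. i \<in> {1..L} \<Longrightarrow> \<bar>vm i\<bar> \<le> R0"
    by (rule velocity_bound) blast
  define R where "R = R0 + \<bar>W\<bar> + 1"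
  have R: "1 \<le> R" "\<And>k. k \<in> {1..K} \<Longrightarrow> W + 2 * \<theta> - vp k \<le> R" "\<And>i. i \<in> {1..L} \<Longrightarrow> \<bar>vm i - (W + \<theta>)\<bar> \<le> R"
    using R0(1) R0(2)[THEN order_trans[OF abs_ge_minus_self]] R0(3) \<theta> by (force simp: R_def)+
  define n where "n = real (K + L)"
  show ?thesis
  proof (cases "K + L = 0")
    case True
    then have "C = {}" using C_in by (force simp: particles_def)
    then show ?thesis by auto
  next
    case False
    then have n: "1 \<le> n" unfolding n_def by linarith
    \<comment> \<open>With this error rate the counting error uses up only half of the imbalance; \<open>B\<close> is chosen
      to outweigh the constant part \<open>D\<close> of the error.\<close>
    define \<delta> where "\<delta> = \<kappa> * \<theta> / (2 * R * R * n)"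
    have \<delta>: "0 < \<delta>" using \<kappa> \<theta> R n by (simp add: \<delta>_def)
    interpret m: particle_field L K "\<lambda>i. - vm i" "\<lambda>k. - vp k" rm rp y x by (rule mirror)
    obtain D1 where D1: "0 \<le> D1" "\<And>k a b. k \<in> {1..K} \<Longrightarrow> 0 \<le> a \<Longrightarrow> a \<le> b \<Longrightarrow> rp k * (b - a) - \<delta> * b - D1 \<le>
      real (card {p \<in> particles K. snd p = k \<and> a \<le> x p \<and> x p < b})"
      using x_uniform[OF \<delta>] by blast
    obtain D2 where D2: "0 \<le> D2" "\<And>i a b. i \<in> {1..L} \<Longrightarrow> a \<le> b \<Longrightarrow>
      real (card {q \<in> particles L. snd q = i \<and> a \<le> y q \<and> y q < b}) \<le> rm i * (b - a) + \<delta> * \<bar>b\<bar> + D2"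
      using m.x_uniform[OF \<delta>] by blast
    define D where "D = D1 + D2"
    have D: "0 \<le> D" "D1 \<le> D" "D2 \<le> D" using D1(1) D2(1) by (auto simp: D_def)
    define B where "B = 2 * R * n * D / (\<kappa> * \<theta>)"
    have B: "0 \<le> B" using R n \<kappa> \<theta> D by (simp add: B_def)
    have "place c < (W + 2 * \<theta>) * tau c + B" if "c \<in> C" for c
    proof (rule ccontr)
      assume "\<not> ?thesis"
      then have "{c \<in> C. (W + 2 * \<theta>) * tau c + B \<le> place c} \<noteq> {}"
        using that by (metis (mono_tags, lifting) empty_Collect_eq not_less)
      from ex_first[OF _ this] obtain c where c: "c \<in> C" "(W + 2 * \<theta>) * tau c + B \<le> place c"
        and first: "\<And>c'. c' \<in> C \<Longrightarrow> (W + 2 * \<theta>) * tau c' + B \<le> place c' \<Longrightarrow> tau c \<le> tau c'"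
        by blast
      define u where "u = tau c"
      have u: "0 < u" using tau_pos[OF C_in[OF c(1)]] by (simp add: u_def)
      have below: "place c' < (W + 2 * \<theta>) * tau c' + B" if "c' \<in> C" "tau c' < u" for c'
        using first[OF that(1)] that(2) unfolding u_def by force
      obtain s where s: "0 \<le> s" "s < u"
        and after: "\<And>c. c \<in> C \<Longrightarrow> s < tau c \<Longrightarrow> tau c < u \<Longrightarrow> (W + \<theta>) * tau c + B / 2 < place c"
        and surv: "\<And>c. c \<in> C \<Longrightarrow> s < tau c \<Longrightarrow>
          - y (snd c) + vm (snd (snd c)) * s \<le> (W + \<theta>) * s + B / 2"
        using ex_last_before[OF u, of "B / 2" "W + \<theta>"] B by auto
      define T where "T = {c \<in> C. s < tau c \<and> tau c < u}"
      have TC: "T \<subseteq> C" by (auto simp: T_def)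
      have finT: "finite T" by (rule finite_subset[OF _ finite_C[of u]]) (auto simp: T_def)
      have inT: "T \<subseteq> particles K \<times> particles L" using TC C_in by blast
      have plus: "flux K vp rp (W + 2 * \<theta>) * (u - s) - real K * (\<delta> * (R * (u + B)) + D) \<le> real (card T)"
      proof -
        have "rp k * max 0 (W + 2 * \<theta> - vp k) * (u - s) - (\<delta> * (R * (u + B)) + D) \<le>
            real (card {p \<in> fst ` T. snd p = k})" if k: "k \<in> {1..K}" for k
        proof -
          have "rp k * max 0 (W + 2 * \<theta> - vp k) * (u - s) - (\<delta> * (R * (u + B)) + D1) \<le>
            real (card {p \<in> fst ` T. snd p = k})"
            unfolding T_def
            by (rule count_plus[OF below, where c=c])
              (use s B c u_def k R D1 \<delta> in auto)
          then show ?thesis using D by linarith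
        qed
        then have "(\<Sum>k = 1..K. rp k * max 0 (W + 2 * \<theta> - vp k) * (u - s) - (\<delta> * (R * (u + B)) + D)) \<le>
            (\<Sum>k = 1..K. real (card {p \<in> fst ` T. snd p = k}))" by (intro sum_mono) auto
        also have "\<dots> = real (\<Sum>k = 1..K. card {p \<in> fst ` T. snd p = k})" by simp
        also have "\<dots> = real (card (fst ` T))"
          using finT inT by (subst card_by_type) auto
        also have "card (fst ` T) = card T" using inj_fst TC by (meson card_image inj_on_subset)
        finally show ?thesis by (simp add: flux_def sum_subtractf sum_distrib_right)
      qed
      have minus: "real (card T) \<le> flux L (\<lambda>i. - vm i) rm (- (W + \<theta>)) * (u - s) + real L * (\<delta> * (R * (u + B)) + D)"
      proof -
        have "real (card {q \<in> snd ` T. snd q = i}) \<le>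
            rm i * max 0 (vm i - (W + \<theta>)) * (u - s) + (\<delta> * (R * (u + B)) + D)" if i: "i \<in> {1..L}" for i
        proof -
          have "real (card {q \<in> snd ` T. snd q = i}) \<le>
            rm i * max 0 (vm i - (W + \<theta>)) * (u - s) + (\<delta> * (R * (u + B / 2)) + D2)"
            unfolding T_def
            by (rule count_minus[OF s(1) _ _ after surv])
              (use s B i R D2 \<delta> in auto)
          moreover have "\<delta> * (R * (u + B / 2)) \<le> \<delta> * (R * (u + B))"
            using \<delta> R B by (intro mult_left_mono) auto
          ultimately show ?thesis using D by linarith
        qed
        then have "(\<Sum>i = 1..L. real (card {q \<in> snd ` T. snd q = i})) \<le>
            (\<Sum>i = 1..L. rm i * max 0 (vm i - (W + \<theta>)) * (u - s) + (\<delta> * (R * (u + B)) + D))"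
          by (intro sum_mono) auto
        also have "(\<Sum>i = 1..L. real (card {q \<in> snd ` T. snd q = i})) =
            real (\<Sum>i = 1..L. card {q \<in> snd ` T. snd q = i})" by simp
        also have "\<dots> = real (card (snd ` T))"
          using finT inT by (subst card_by_type) auto
        also have "card (snd ` T) = card T" using inj_snd TC by (meson card_image inj_on_subset)
        finally have "real (card T) \<le>
            (\<Sum>i = 1..L. rm i * max 0 (vm i - (W + \<theta>)) * (u - s) + (\<delta> * (R * (u + B)) + D))" .
        moreover have "flux L (\<lambda>i. - vm i) rm (- (W + \<theta>)) = (\<Sum>i = 1..L. rm i * max 0 (vm i - (W + \<theta>)))"
          unfolding flux_def by (intro sum.cong) (auto simp: algebra_simps)
        ultimately show ?thesis by (simp add: sum.distrib sum_distrib_right)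
      qed
      \<comment> \<open>Each collision removes one particle of either sign, so the two counts can be compared.\<close>
      have main: "\<kappa> * (u - s) \<le> n * (\<delta> * (R * (u + B)) + D)"
        using plus minus by (simp add: \<kappa>_def n_def algebra_simps)
      \<comment> \<open>The minus particle of \<open>c\<close> is not beyond the flat barrier at time \<open>s\<close> and on or beyond the steep one at
        time \<open>u\<close>.\<close>
      have dist: "\<theta> * (u + B) \<le> R * (u - s)"
      proof -
        define v where "v = vm (snd (snd c))"
        have cin: "snd (snd c) \<in> {1..L}" using C_in[OF c(1)] by (auto simp: particles_def)
        have "- y (snd c) + v * s \<le> (W + \<theta>) * s + B / 2"
          using surv[OF c(1)] s u_def by (simp add: v_def)
        moreover have "(W + 2 * \<theta>) * u + B \<le> - y (snd c) + v * u"
          using c(2) place_minus[OF C_in[OF c(1)]] by (simp add: v_def u_def)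
        ultimately have "\<theta> * u + B / 2 \<le> (v - (W + \<theta>)) * (u - s)" by (simp add: algebra_simps)
        also have "\<dots> \<le> R * (u - s)"
          using R(3)[OF cin] s by (intro mult_right_mono) (auto simp: v_def)
        finally have "\<theta> * u + B / 2 \<le> R * (u - s)" .
        moreover have "\<theta> * B \<le> B / 2" using \<theta>(3) B mult_right_mono[of \<theta> "1/2" B] by simp
        ultimately show ?thesis by (simp add: algebra_simps)
      qed
      have "\<kappa> * (\<theta> * (u + B)) \<le> \<kappa> * (R * (u - s))" using dist \<kappa> by simp
      also have "\<dots> = R * (\<kappa> * (u - s))" by simp
      also have "\<dots> \<le> R * (n * (\<delta> * (R * (u + B)) + D))" using main R by (intro mult_left_mono) auto
      also have "\<dots> = \<kappa> * \<theta> * (u + B) / 2 + R * n * D"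
        using R n by (simp add: \<delta>_def field_simps)
      finally have "\<kappa> * \<theta> * (u + B) \<le> 2 * R * n * D" by simp
      moreover have "\<kappa> * \<theta> * B = 2 * R * n * D" using \<kappa> \<theta> by (simp add: B_def)
      moreover have "0 < \<kappa> * \<theta> * u" using \<kappa> \<theta> u by simp
      ultimately show False by (simp add: distrib_left)
    qed
    moreover have "(W + 2 * \<theta>) * tau c + B \<le> (W + \<epsilon>) * tau c + B" if "c \<in> C" for c
      using \<theta> tau_pos[OF C_in[OF that]] by (intro add_right_mono mult_right_mono) auto
    ultimately show ?thesis using B by (meson order_less_le_trans)
  qed
qed

end

section \<open>Velocity of the last collision\<close>

context particle_field
begin

lemma ex_particle_in_window:
  assumes k: "k \<in> {1..K}" and "0 \<le> \<alpha>" "0 \<le> b" "0 < \<delta>"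
  shows "\<exists>T>0. \<forall>t\<ge>T. \<exists>p\<in>particles K. snd p = k \<and> \<alpha> * t + b \<le> x p \<and> x p < \<alpha> * t + b + \<delta> * t"
proof -
  define \<delta>' where "\<delta>' = rp k * \<delta> / (2 * (\<alpha> + \<delta>))"
  have r: "0 < rp k" by (rule rp_pos[OF k])
  have \<delta>': "0 < \<delta>'" using r assms by (simp add: \<delta>'_def)
  obtain D where D: "0 \<le> D" "\<And>a b. 0 \<le> a \<Longrightarrow> a \<le> b \<Longrightarrow> rp k * (b - a) - \<delta>' * b - D \<le>
      real (card {p \<in> particles K. snd p = k \<and> a \<le> x p \<and> x p < b})"
    using x_uniform[OF \<delta>'] k by blast
  define T where "T = 2 * (\<delta>' * b + D) / (rp k * \<delta>) + 1"
  have T: "0 < T" using assms D \<delta>' r by (auto simp: T_def intro!: add_nonneg_pos)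
  have "\<exists>p\<in>particles K. snd p = k \<and> \<alpha> * t + b \<le> x p \<and> x p < \<alpha> * t + b + \<delta> * t" if t: "T \<le> t" for t
  proof -
    have "2 * (\<delta>' * b + D) / (rp k * \<delta>) < t" using t by (simp add: T_def)
    then have "2 * (\<delta>' * b + D) < rp k * \<delta> * t" using r assms by (simp add: field_simps)
    moreover have "\<delta>' * (\<alpha> * t + b + \<delta> * t) = rp k * \<delta> * t / 2 + \<delta>' * b"
    proof -
      have "\<delta>' * (\<alpha> + \<delta>) = rp k * \<delta> / 2" using assms by (simp add: \<delta>'_def field_simps)
      then have "\<delta>' * (\<alpha> + \<delta>) * t = rp k * \<delta> / 2 * t" by (simp only:)
      moreover have "\<delta>' * (\<alpha> * t + b + \<delta> * t) = \<delta>' * (\<alpha> + \<delta>) * t + \<delta>' * b"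
        by (simp add: algebra_simps)
      ultimately show ?thesis by simp
    qed
    moreover have "0 \<le> \<alpha> * t" "0 \<le> \<delta> * t" using assms T t by auto
    ultimately have "0 < real (card {p \<in> particles K. snd p = k \<and> \<alpha> * t + b \<le> x p \<and> x p < \<alpha> * t + b + \<delta> * t})"
      using D(2)[of "\<alpha> * t + b" "\<alpha> * t + b + \<delta> * t"] assms by (simp add: algebra_simps)
    then have "{p \<in> particles K. snd p = k \<and> \<alpha> * t + b \<le> x p \<and> x p < \<alpha> * t + b + \<delta> * t} \<noteq> {}"
      by (metis card.empty of_nat_0 less_irrefl)
    then show ?thesis by blast
  qed
  with T show ?thesis by blast
qed

end

context annihilation
begin

lemma lower_barrier:
  assumes bal: "flux K vp rp W = flux L (\<lambda>i. - vm i) rm (- W)" and pos: "0 < flux K vp rp W"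
    and \<epsilon>: "0 < \<epsilon>"
  shows "\<exists>B\<ge>0. \<forall>c\<in>C. (W - \<epsilon>) * tau c - B < place c"
proof -
  interpret m: annihilation L K "\<lambda>i. - vm i" "\<lambda>k. - vp k" rm rp y x "prod.swap ` C"
    by (rule mirror_annihilation)
  obtain B where B: "0 \<le> B" "\<And>c. c \<in> C \<Longrightarrow> m.place (prod.swap c) < (- W + \<epsilon>) * m.tau (prod.swap c) + B"
    using m.upper_barrier[of "- W" \<epsilon>] bal pos \<epsilon> by auto
  have "(W - \<epsilon>) * tau c - B < place c" if "c \<in> C" for c
  proof -
    have "m.tau (prod.swap c) = tau c" by (simp add: meet_def add.commute)
    moreover from this have "m.place (prod.swap c) = - place c"
      using place_minus[OF C_in[OF that]] by (simp add: m.place_def)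
    ultimately show ?thesis using B(2)[OF that] by (simp add: algebra_simps)
  qed
  with B(1) show ?thesis by blast
qed

text \<open>
  Without collisions between \<open>(1 - \<eta>) * t\<close> and \<open>t\<close>, the barriers would leave alive at time \<open>t\<close>
  a plus particle of a type with \<open>vp k < W\<close> and a minus particle of a type with \<open>W < vm i\<close>
  that were both close to the line \<open>W * t\<close> already at time \<open>(1 - \<eta>) * t\<close>. They would have
  passed each other.
\<close>

lemma recent_collision:
  assumes bal: "flux K vp rp W = flux L (\<lambda>i. - vm i) rm (- W)" and pos: "0 < flux K vp rp W"
    and \<eta>: "0 < \<eta>" "\<eta> < 1"
  shows "\<exists>T>0. \<forall>t\<ge>T. \<exists>c\<in>C. (1 - \<eta>) * t \<le> tau c \<and> tau c < t"
proof -
  interpret m: particle_field L K "\<lambda>i. - vm i" "\<lambda>k. - vp k" rm rp y x by (rule mirror)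
  obtain k where k: "k \<in> {1..K}" "vp k < W"
    using ex_slower_than_front[OF pos] rp_pos by blast
  obtain i where i: "i \<in> {1..L}" "W < vm i"
    using ex_slower_than_front[of L "\<lambda>i. - vm i" rm "- W"] pos bal rm_pos by auto
  define w where "w = vm i - vp k"
  define \<epsilon> where "\<epsilon> = w * \<eta> / 8"
  have w: "0 < w" using k i by (simp add: w_def)
  have \<epsilon>: "0 < \<epsilon>" using w \<eta> by (simp add: \<epsilon>_def)
  obtain B1 where B1: "0 \<le> B1" "\<And>c. c \<in> C \<Longrightarrow> place c < (W + \<epsilon>) * tau c + B1"
    using upper_barrier[OF bal pos \<epsilon>] by blast
  obtain B2 where B2: "0 \<le> B2" "\<And>c. c \<in> C \<Longrightarrow> (W - \<epsilon>) * tau c - B2 < place c"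
    using lower_barrier[OF bal pos \<epsilon>] by blast
  define \<alpha> where "\<alpha> = (W + \<epsilon> - vp k) * (1 - \<eta>)"
  define \<alpha>' where "\<alpha>' = (vm i - W + \<epsilon>) * (1 - \<eta>)"
  have \<alpha>: "0 \<le> \<alpha>" "0 \<le> \<alpha>'" using k i \<epsilon> \<eta> by (auto simp: \<alpha>_def \<alpha>'_def)
  obtain T1 where T1: "0 < T1" "\<And>t. T1 \<le> t \<Longrightarrow>
      \<exists>p\<in>particles K. snd p = k \<and> \<alpha> * t + B1 \<le> x p \<and> x p < \<alpha> * t + B1 + \<epsilon> * t"
    using ex_particle_in_window[OF k(1) \<alpha>(1) B1(1) \<epsilon>] by blast
  obtain T2 where T2: "0 < T2" "\<And>t. T2 \<le> t \<Longrightarrow>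
      \<exists>q\<in>particles L. snd q = i \<and> \<alpha>' * t + B2 \<le> y q \<and> y q < \<alpha>' * t + B2 + \<epsilon> * t"
    using m.ex_particle_in_window[OF i(1) \<alpha>(2) B2(1) \<epsilon>] by blast
  define T where "T = max (max T1 T2) (2 * (B1 + B2) / (w * \<eta>) + 1)"
  have "\<exists>c\<in>C. (1 - \<eta>) * t \<le> tau c \<and> tau c < t" if t: "T \<le> t" for t
  proof (rule ccontr)
    assume none: "\<not> ?thesis"
    have tT: "T1 \<le> t" "T2 \<le> t" "2 * (B1 + B2) / (w * \<eta>) < t" using t by (auto simp: T_def)
    obtain p where p: "p \<in> particles K" "snd p = k" "\<alpha> * t + B1 \<le> x p" "x p < \<alpha> * t + B1 + \<epsilon> * t"
      using T1(2)[OF tT(1)] by blast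
    obtain q where q: "q \<in> particles L" "snd q = i" "\<alpha>' * t + B2 \<le> y q" "y q < \<alpha>' * t + B2 + \<epsilon> * t"
      using T2(2)[OF tT(2)] by blast
    have early: "tau c < (1 - \<eta>) * t" if "c \<in> C" "tau c < t" for c
      using none that by force
    have "fst c \<noteq> p \<and> snd c \<noteq> q" if c: "c \<in> C" "tau c < t" for c
    proof (intro conjI notI)
      assume "fst c = p"
      then have "x p < (W + \<epsilon> - vp k) * tau c + B1"
        using B1(2)[OF c(1)] p(2) by (simp add: place_def algebra_simps)
      moreover have "(W + \<epsilon> - vp k) * tau c \<le> (W + \<epsilon> - vp k) * ((1 - \<eta>) * t)"
        using early[OF c] k \<epsilon> by (intro mult_left_mono) auto
      ultimately show False using p(3) by (simp add: \<alpha>_def mult.assoc)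
    next
      assume "snd c = q"
      then have "y q < (vm i - W + \<epsilon>) * tau c + B2"
        using B2(2)[OF c(1)] place_minus[OF C_in[OF c(1)]] q(2) by (simp add: algebra_simps)
      moreover have "(vm i - W + \<epsilon>) * tau c \<le> (vm i - W + \<epsilon>) * ((1 - \<eta>) * t)"
        using early[OF c] i \<epsilon> by (intro mult_left_mono) auto
      ultimately show False using q(3) by (simp add: \<alpha>'_def mult.assoc)
    qed
    then have "\<not> tau (p, q) < t" using dead_if_crossed[OF p(1) q(1)] by blast
    then have "w * t \<le> x p + y q"
      using tau_less_iff[of "(p, q)" t] p q by (simp add: w_def algebra_simps)
    also have "\<dots> \<le> (\<alpha> + \<alpha>') * t + 2 * \<epsilon> * t + (B1 + B2)" using p(4) q(4) by (simp add: algebra_simps)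
    also have "\<alpha> + \<alpha>' = (w + 2 * \<epsilon>) * (1 - \<eta>)" by (simp add: \<alpha>_def \<alpha>'_def w_def algebra_simps)
    also have "(w + 2 * \<epsilon>) * (1 - \<eta>) * t + 2 * \<epsilon> * t + (B1 + B2) =
        (w - 4 * \<epsilon> - 2 * \<epsilon> * \<eta>) * t + (B1 + B2)"
    proof -
      have "(w + 2 * \<epsilon>) * (1 - \<eta>) + 2 * \<epsilon> = w - w * \<eta> + 4 * \<epsilon> - 2 * \<epsilon> * \<eta>"
        by (simp add: algebra_simps)
      also have "w * \<eta> = 8 * \<epsilon>" by (simp add: \<epsilon>_def)
      finally have "((w + 2 * \<epsilon>) * (1 - \<eta>) + 2 * \<epsilon>) * t = (w - 4 * \<epsilon> - 2 * \<epsilon> * \<eta>) * t" by simp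
      then show ?thesis by (simp only: distrib_right)
    qed
    finally have "4 * \<epsilon> * t + 2 * \<epsilon> * \<eta> * t \<le> B1 + B2" by (simp add: algebra_simps)
    moreover have "0 \<le> 2 * \<epsilon> * \<eta> * t" using \<epsilon> \<eta> tT(1) T1(1) by simp
    moreover have "B1 + B2 < 4 * \<epsilon> * t" using tT(3) w \<eta> by (simp add: \<epsilon>_def field_simps)
    ultimately show False by linarith
  qed
  moreover have "0 < T" using T1 by (simp add: T_def)
  ultimately show ?thesis by blast
qed

text \<open>
  For \<open>t\<close> before the first collision nothing is assumed about \<open>\<beta>\<close>. If several collisions occur
  at the last time, \<open>\<beta>\<close> may be the position of any of them.
\<close>

lemma last_collision_velocity:
  assumes bal: "flux K vp rp W = flux L (\<lambda>i. - vm i) rm (- W)" and pos: "0 < flux K vp rp W"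
    and \<beta>: "\<And>t. {c \<in> C. tau c < t} \<noteq> {} \<Longrightarrow>
      \<exists>c\<in>C. tau c < t \<and> (\<forall>c'\<in>C. tau c' < t \<longrightarrow> tau c' \<le> tau c) \<and> \<beta> t = place c"
  shows "((\<lambda>t. \<beta> t / t) \<longlongrightarrow> W) at_top"
proof (rule tendstoI)
  fix \<epsilon> :: real assume \<epsilon>: "0 < \<epsilon>"
  define \<eta> where "\<eta> = min (1 / 2) (\<epsilon> / (4 * (\<bar>W\<bar> + 1)))"
  have \<eta>: "0 < \<eta>" "\<eta> < 1" using \<epsilon> by (auto simp: \<eta>_def intro!: divide_pos_pos)
  have "\<bar>W\<bar> * \<eta> \<le> (\<bar>W\<bar> + 1) * (\<epsilon> / (4 * (\<bar>W\<bar> + 1)))"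
    unfolding \<eta>_def using \<epsilon> by (intro mult_mono) auto
  also have "\<dots> = \<epsilon> / 4" by (simp add: field_simps add_nonneg_eq_0_iff)
  finally have W\<eta>: "\<bar>W\<bar> * \<eta> \<le> \<epsilon> / 4" .
  have \<epsilon>4: "0 < \<epsilon> / 4" using \<epsilon> by simp
  obtain B1 where B1: "0 \<le> B1" "\<And>c. c \<in> C \<Longrightarrow> place c < (W + \<epsilon> / 4) * tau c + B1"
    using upper_barrier[OF bal pos \<epsilon>4] by blast
  obtain B2 where B2: "0 \<le> B2" "\<And>c. c \<in> C \<Longrightarrow> (W - \<epsilon> / 4) * tau c - B2 < place c"
    using lower_barrier[OF bal pos \<epsilon>4] by blast
  obtain T where T: "0 < T" "\<And>t. T \<le> t \<Longrightarrow> \<exists>c\<in>C. (1 - \<eta>) * t \<le> tau c \<and> tau c < t"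
    using recent_collision[OF bal pos \<eta>] by blast
  have "dist (\<beta> t / t) W < \<epsilon>" if t: "max T (4 * (B1 + B2) / \<epsilon>) \<le> t" for t
  proof -
    have t0: "0 < t" "T \<le> t" using t T(1) by auto
    obtain c' where c': "c' \<in> C" "(1 - \<eta>) * t \<le> tau c'" "tau c' < t" using T(2)[OF t0(2)] by blast
    then have "{c \<in> C. tau c < t} \<noteq> {}" by blast
    from \<beta>[OF this] obtain c where c: "c \<in> C" "tau c < t" "tau c' \<le> tau c" "\<beta> t = place c"
      using c' by blast
    have "\<bar>place c - W * tau c\<bar> \<le> \<epsilon> / 4 * tau c + (B1 + B2)"
      using B1(2)[OF c(1)] B2(2)[OF c(1)] B1(1) B2(1) by (simp add: abs_le_iff algebra_simps)
    also have "\<dots> \<le> \<epsilon> / 4 * t + (B1 + B2)" using c(2) \<epsilon> by simp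
    also have "B1 + B2 \<le> \<epsilon> / 4 * t" using t \<epsilon> by (simp add: field_simps)
    finally have 1: "\<bar>place c - W * tau c\<bar> \<le> \<epsilon> / 2 * t" by (simp add: field_simps)
    have "\<bar>W * tau c - W * t\<bar> = \<bar>W\<bar> * (t - tau c)"
      using c(2) by (simp add: abs_mult flip: right_diff_distrib)
    also have "\<dots> \<le> \<bar>W\<bar> * (\<eta> * t)" using c(3) c'(2) by (intro mult_left_mono) (auto simp: algebra_simps)
    also have "\<dots> \<le> \<epsilon> / 4 * t" using mult_right_mono[OF W\<eta>, of t] t0 by (simp add: mult.assoc)
    finally have 2: "\<bar>W * tau c - W * t\<bar> \<le> \<epsilon> / 4 * t" .
    have "\<bar>place c - W * t\<bar> \<le> \<bar>place c - W * tau c\<bar> + \<bar>W * tau c - W * t\<bar>"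
      using abs_triangle_ineq[of "place c - W * tau c" "W * tau c - W * t"] by simp
    also have "\<dots> \<le> \<epsilon> * 3 / 4 * t" using 1 2 by simp
    finally have "\<bar>place c - W * t\<bar> \<le> \<epsilon> * 3 / 4 * t" .
    also have "\<dots> < \<epsilon> * t" using \<epsilon> t0 by simp
    finally have "\<bar>place c - W * t\<bar> / t < \<epsilon>" using t0 by (simp add: field_simps)
    moreover have "\<beta> t / t - W = (place c - W * t) / t" using t0 c(4) by (simp add: field_simps)
    ultimately show ?thesis using t0 by (simp add: dist_real_def)
  qed
  then show "\<forall>\<^sub>F t in at_top. dist (\<beta> t / t) W < \<epsilon>"
    unfolding eventually_at_top_linorder by blast
qed

end

section \<open>Velocity of the boundary\<close>

lemma meeting_time_eq_meet:
  "meeting_time vp vm gp gm = meet vp vm (initial_distance gp) (initial_distance gm)"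
  by (simp add: fun_eq_iff meeting_time_def meet_def)

lemma initial_distance_less:
  assumes "\<And>j. j \<ge> 1 \<Longrightarrow> 0 < g j k" and "i < j"
  shows "initial_distance g (i, k) < initial_distance g (j, k)"
proof -
  have "(\<Sum>m = 1..i. g m k) < (\<Sum>m = 1..j. g m k)"
    using assms by (intro sum_strict_mono2[of _ _ j]) (auto simp: less_imp_le)
  then show ?thesis by (simp add: initial_distance_def)
qed

lemma initial_distance_pos:
  assumes "\<And>j k. j \<ge> 1 \<Longrightarrow> k \<in> {1..n} \<Longrightarrow> 0 < g j k" and "p \<in> particles n"
  shows "0 < initial_distance g p"
  using assms unfolding initial_distance_def by (intro sum_pos) (auto simp: particles_def)

lemma initial_distance_inj:
  assumes g: "\<And>j. j \<ge> 1 \<Longrightarrow> 0 < g j k" and eq: "snd p = k" "snd q = k" "initial_distance g p = initial_distance g q"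
  shows "p = q"
proof -
  have "fst p = fst q"
    using initial_distance_less[of g k "fst p" "fst q"] initial_distance_less[of g k "fst q" "fst p"] g eq
    by (metis less_irrefl nat_neq_iff prod.collapse)
  then show ?thesis using eq by (simp add: prod_eq_iff)
qed

lemma initial_distance_density:
  assumes g: "\<And>j. j \<ge> 1 \<Longrightarrow> 0 < g j k" and k: "k \<in> {1..n}"
    and lim: "(\<lambda>j. (\<Sum>m = 1..j. g m k) / j) \<longlonglongrightarrow> \<mu>" and \<mu>: "0 < \<mu>"
  shows "has_density (1 / \<mu>) {p \<in> particles n. snd p = k} (initial_distance g)"
proof -
  have "has_density (1 / \<mu>) {1..} (initial_distance g \<circ> (\<lambda>j. (j, k)))"
  proof (rule has_density_sequence)
    show "(\<lambda>j. (initial_distance g \<circ> (\<lambda>j. (j, k))) j / real j) \<longlonglongrightarrow> \<mu>"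
      using lim by (simp add: initial_distance_def)
    show "0 < (initial_distance g \<circ> (\<lambda>j. (j, k))) j" if "1 \<le> j" for j
      using g that by (auto simp: initial_distance_def intro!: sum_pos)
    show "(initial_distance g \<circ> (\<lambda>j. (j, k))) i \<le> (initial_distance g \<circ> (\<lambda>j. (j, k))) j"
      if "1 \<le> i" "i \<le> j" for i j
      using initial_distance_less[of g k i j] g that by (cases "i = j") auto
  qed (rule \<mu>)
  then have "has_density (1 / \<mu>) ((\<lambda>j. (j, k)) ` {1..}) (initial_distance g)"
    by (rule has_density_image) (auto simp: inj_on_def)
  also have "(\<lambda>j. (j, k)) ` {1..} = {p \<in> particles n. snd p = k}"
    using k by (auto simp: particles_def)
  finally show ?thesis .
qed

text \<open>
  The theorem for one realization: the only properties of the random configuration that matter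
  are positive gaps, the law of large numbers for the gaps of each type, and that no particle
  meets particles of two different types at the same time.
\<close>

lemma boundary_velocity:
  fixes vp vm rp rm :: "nat \<Rightarrow> real" and gp gm :: "nat \<Rightarrow> nat \<Rightarrow> real"
  assumes K: "K \<ge> 1" and L: "L \<ge> 1"
    and vp: "strict_mono_on {1..K} vp" "\<And>k. k \<in> {1..K} \<Longrightarrow> vp k < 0"
    and vm: "strict_antimono_on {1..L} vm" "\<And>i. i \<in> {1..L} \<Longrightarrow> vm i > 0"
    and gp: "\<And>j k. j \<ge> 1 \<Longrightarrow> k \<in> {1..K} \<Longrightarrow> 0 < gp j k"
    and gm: "\<And>j i. j \<ge> 1 \<Longrightarrow> i \<in> {1..L} \<Longrightarrow> 0 < gm j i"
    and lp: "\<And>k. k \<in> {1..K} \<Longrightarrow> (\<lambda>j. (\<Sum>m = 1..j. gp m k) / j) \<longlonglongrightarrow> mp k"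
    and lm: "\<And>i. i \<in> {1..L} \<Longrightarrow> (\<lambda>j. (\<Sum>m = 1..j. gm m i) / j) \<longlonglongrightarrow> mm i"
    and mp: "\<And>k. k \<in> {1..K} \<Longrightarrow> 0 < mp k" and mm: "\<And>i. i \<in> {1..L} \<Longrightarrow> 0 < mm i"
    and rp: "\<And>k. k \<in> {1..K} \<Longrightarrow> rp k = 1 / mp k" and rm: "\<And>i. i \<in> {1..L} \<Longrightarrow> rm i = 1 / mm i"
    and tie_plus: "\<And>p q q'. p \<in> particles K \<Longrightarrow> q \<in> particles L \<Longrightarrow> q' \<in> particles L \<Longrightarrow> snd q \<noteq> snd q' \<Longrightarrow>
      meeting_time vp vm gp gm (p, q) \<noteq> meeting_time vp vm gp gm (p, q')"
    and tie_minus: "\<And>p p' q. p \<in> particles K \<Longrightarrow> p' \<in> particles K \<Longrightarrow> q \<in> particles L \<Longrightarrow> snd p \<noteq> snd p' \<Longrightarrow>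
      meeting_time vp vm gp gm (p, q) \<noteq> meeting_time vp vm gp gm (p', q)"
    and L1: "L1 = Max {l \<in> {1..L}. vm l > V vm rm vp rp {1..l} {1..K}}"
    and K1: "K1 = Max {k \<in> {1..K}. vp k < V vm rm vp rp {1..L} {1..k}}"
  shows "((\<lambda>t. boundary K L vp vm gp gm t / t) \<longlongrightarrow> V vm rm vp rp {1..L1} {1..K1}) at_top"
proof -
  define W where "W = V vm rm vp rp {1..L1} {1..K1}"
  have rp_pos: "0 < rp k" if "k \<in> {1..K}" for k using rp[OF that] mp[OF that] by simp
  have rm_pos: "0 < rm i" if "i \<in> {1..L}" for i using rm[OF that] mm[OF that] by simp
  note bal = balance_velocity[OF K L vp vm rp_pos rm_pos L1 K1 W_def]
  interpret F: particle_field K L vp vm rp rm "initial_distance gp" "initial_distance gm"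
  proof
    show "vp k < vm i" if "k \<in> {1..K}" "i \<in> {1..L}" for k i
      using vp(2)[OF that(1)] vm(2)[OF that(2)] by simp
    show "0 < initial_distance gp p" if "p \<in> particles K" for p using initial_distance_pos gp that by blast
    show "0 < initial_distance gm p" if "p \<in> particles L" for p using initial_distance_pos gm that by blast
    show "has_density (rp k) {p \<in> particles K. snd p = k} (initial_distance gp)" if "k \<in> {1..K}" for k
      unfolding rp[OF that] by (rule initial_distance_density) (use gp lp mp that in auto)
    show "has_density (rm i) {p \<in> particles L. snd p = i} (initial_distance gm)" if "i \<in> {1..L}" for i
      unfolding rm[OF that] by (rule initial_distance_density) (use gm lm mm that in auto)
  qed (use rp_pos rm_pos in auto)
  define C where "C = collisions K L vp vm gp gm"
  have C: "is_collision_set (particles K) (particles L) F.tau C"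
    unfolding C_def collisions_def meeting_time_eq_meet
    by (rule theI') (rule ex1_is_collision_set[OF F.finite_early])
  have same_time: "F.tau c = F.tau c'" if "c \<in> C" "c' \<in> C" "fst c = fst c' \<or> snd c = snd c'" for c c'
  proof -
    have "\<not> F.tau c' < F.tau c" if "c \<in> C" "c' \<in> C" "fst c = fst c' \<or> snd c = snd c'" for c c'
      using C that unfolding is_collision_set_def by (cases c; cases c') fastforce
    from this[of c c'] this[of c' c] that show ?thesis by force
  qed
  have Cin: "fst c \<in> particles K" "snd c \<in> particles L" if "c \<in> C" for c
    using C that by (auto simp: is_collision_set_def)
  have types: "snd p \<in> {1..n}" if "p \<in> particles n" for p n using that by (auto simp: particles_def)
  interpret A: annihilation K L vp vm rp rm "initial_distance gp" "initial_distance gm" C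
  proof
    show "is_collision_set (particles K) (particles L) F.tau C" by (rule C)
    show "inj_on fst C"
    proof (rule inj_onI)
      fix c c' assume c: "c \<in> C" "c' \<in> C" "fst c = fst c'"
      have eq: "F.tau (fst c, snd c) = F.tau (fst c, snd c')" using same_time[OF c(1,2)] c(3)
        by (metis prod.collapse)
      then have s: "snd (snd c) = snd (snd c')"
        using tie_plus[OF Cin(1)[OF c(1)] Cin(2)[OF c(1)] Cin(2)[OF c(2)]]
        unfolding meeting_time_eq_meet by blast
      have "vp (snd (fst c)) < vm (snd (snd c))"
        using F.v_less types Cin c by blast
      then have "initial_distance gm (snd c) = initial_distance gm (snd c')"
        using eq s by (simp add: meet_def)
      then have "snd c = snd c'"
        using initial_distance_inj[of gm "snd (snd c)"] gm types Cin c s by metis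
      then show "c = c'" using c(3) by (simp add: prod_eq_iff)
    qed
    show "inj_on snd C"
    proof (rule inj_onI)
      fix c c' assume c: "c \<in> C" "c' \<in> C" "snd c = snd c'"
      have eq: "F.tau (fst c, snd c) = F.tau (fst c', snd c)" using same_time[OF c(1,2)] c(3)
        by (metis prod.collapse)
      then have s: "snd (fst c) = snd (fst c')"
        using tie_minus[OF Cin(1)[OF c(1)] Cin(1)[OF c(2)] Cin(2)[OF c(1)]]
        unfolding meeting_time_eq_meet by blast
      have "vp (snd (fst c)) < vm (snd (snd c))"
        using F.v_less types Cin c by blast
      then have "initial_distance gp (fst c) = initial_distance gp (fst c')"
        using eq s by (simp add: meet_def)
      then have "fst c = fst c'"
        using initial_distance_inj[of gp "snd (fst c)"] gp types Cin c s by metis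
      then show "c = c'" using c(3) by (simp add: prod_eq_iff)
    qed
  qed
  have "((\<lambda>t. boundary K L vp vm gp gm t / t) \<longlongrightarrow> W) at_top"
  proof (rule A.last_collision_velocity[OF bal])
    fix t assume ne: "{c \<in> C. F.tau c < t} \<noteq> {}"
    define S where "S = {c \<in> C. F.tau c < t}"
    have "finite S" unfolding S_def by (rule A.finite_C)
    then have "\<exists>c. is_arg_max F.tau (\<lambda>c. c \<in> S) c"
      using ex_is_arg_min_if_finite[of S "\<lambda>c. - F.tau c"] ne
      by (simp add: is_arg_min_def is_arg_max_def S_def)
    then have "is_arg_max F.tau (\<lambda>c. c \<in> S) (arg_max_on F.tau S)"
      unfolding arg_max_on_def arg_max_def by (rule someI_ex)
    then have max: "arg_max_on F.tau S \<in> S" "\<forall>c\<in>S. F.tau c \<le> F.tau (arg_max_on F.tau S)"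
      unfolding is_arg_max_linorder by blast+
    have "boundary K L vp vm gp gm t = F.place (arg_max_on F.tau S)"
      using ne unfolding boundary_def Let_def meeting_time_eq_meet C_def[symmetric] S_def[symmetric]
      by (simp add: F.place_def plus_position_def)
    with max show "\<exists>c\<in>C. F.tau c < t \<and> (\<forall>c'\<in>C. F.tau c' < t \<longrightarrow> F.tau c' \<le> F.tau c) \<and>
        boundary K L vp vm gp gm t = F.place c"
      by (intro bexI[of _ "arg_max_on F.tau S"]) (auto simp: S_def)
  qed
  then show ?thesis by (simp only: W_def)
qed

lemma (in prob_space) strong_law_partial_sums:
  fixes u :: "nat \<Rightarrow> 'a \<Rightarrow> real"
  assumes "indep_vars (\<lambda>_. borel) u {1..}"
    and "\<And>j. j \<ge> 1 \<Longrightarrow> distr M borel (u j) = distr M borel (u 1)" and "integrable M (u 1)"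
  shows "AE \<omega> in M. (\<lambda>n. (\<Sum>j = 1..n. u j \<omega>) / n) \<longlonglongrightarrow> expectation (u 1)"
proof -
  have "indep_vars (\<lambda>_. borel) (\<lambda>i. u (Suc i)) UNIV"
    using indep_vars_reindex[where f=Suc and I=UNIV and X=u and M'="\<lambda>_. borel"]
      indep_vars_subset[OF assms(1), of "range Suc"] by auto
  then have "AE \<omega> in M. (\<lambda>n. (\<Sum>i<n. u (Suc i) \<omega>) / n) \<longlonglongrightarrow> expectation (u (Suc 0))"
    using assms(2)[of "Suc i" for i] assms(3) by (intro strong_law_of_large_numbers) auto
  then show ?thesis by (simp add: sum.atLeast1_atMost_eq)
qed

theorem theorem1:
  fixes M :: "'a measure"
    and K L :: nat
    and vp vm rp rm :: "nat \<Rightarrow> real"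
    and up um :: "nat \<Rightarrow> nat \<Rightarrow> 'a \<Rightarrow> real"
    and L1 K1 :: nat
  assumes "prob_space M"
    and "K \<ge> 1" and "L \<ge> 1"
    and "strict_mono_on {1..K} vp" and "\<And>k. k \<in> {1..K} \<Longrightarrow> vp k < 0"
    and "strict_antimono_on {1..L} vm" and "\<And>i. i \<in> {1..L} \<Longrightarrow> vm i > 0"
    and "prob_space.indep_vars M (\<lambda>_. borel)
           (case_sum (\<lambda>(j, k). up j k) (\<lambda>(j, i). um j i)) (particles K <+> particles L)"
    and "\<And>j k. j \<ge> 1 \<Longrightarrow> k \<in> {1..K} \<Longrightarrow> AE \<omega> in M. up j k \<omega> > 0"
    and "\<And>j i. j \<ge> 1 \<Longrightarrow> i \<in> {1..L} \<Longrightarrow> AE \<omega> in M. um j i \<omega> > 0"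
    and "\<And>j k. j \<ge> 1 \<Longrightarrow> k \<in> {1..K} \<Longrightarrow> distr M borel (up j k) = distr M borel (up 1 k)"
    and "\<And>j i. j \<ge> 1 \<Longrightarrow> i \<in> {1..L} \<Longrightarrow> distr M borel (um j i) = distr M borel (um 1 i)"
    and "\<And>k. k \<in> {1..K} \<Longrightarrow> absolutely_continuous lborel (distr M borel (up 1 k))"
    and "\<And>i. i \<in> {1..L} \<Longrightarrow> absolutely_continuous lborel (distr M borel (um 1 i))"
    and "\<And>k. k \<in> {1..K} \<Longrightarrow> integrable M (up 1 k)"
    and "\<And>i. i \<in> {1..L} \<Longrightarrow> integrable M (um 1 i)"
    and "\<And>k. k \<in> {1..K} \<Longrightarrow> rp k = 1 / (\<integral>\<omega>. up 1 k \<omega> \<partial>M)"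
    and "\<And>i. i \<in> {1..L} \<Longrightarrow> rm i = 1 / (\<integral>\<omega>. um 1 i \<omega> \<partial>M)"
    and "{V vm rm vp rp Jm Jp | Jm Jp. Jm \<noteq> {} \<and> Jm \<subseteq> {1..L} \<and> Jp \<noteq> {} \<and> Jp \<subseteq> {1..K}}
           \<inter> (vm ` {1..L} \<union> vp ` {1..K}) = {}"
    and "L1 = Max {l \<in> {1..L}. vm l > V vm rm vp rp {1..l} {1..K}}"
    and "K1 = Max {k \<in> {1..K}. vp k < V vm rm vp rp {1..L} {1..k}}"
  shows "AE \<omega> in M.
           ((\<lambda>t. boundary K L vp vm (\<lambda>j k. up j k \<omega>) (\<lambda>j i. um j i \<omega>) t / t)
              \<longlongrightarrow> V vm rm vp rp {1..L1} {1..K1}) at_top"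
proof -
  interpret prob_space M by fact
  note K = assms(2) and L = assms(3) and vp = assms(4,5) and vm = assms(6,7) and indep = assms(8)
    and up_pos = assms(9) and um_pos = assms(10) and up_same = assms(11) and um_same = assms(12)
    and up_ac = assms(13) and um_ac = assms(14) and up_int = assms(15) and um_int = assms(16)
    and rp = assms(17) and rm = assms(18) and L1 = assms(20) and K1 = assms(21)
  define U where "U = case_sum (\<lambda>(j, k). up j k) (\<lambda>(j, i). um j i)"
  have U: "U (Inl (j, k)) = up j k" "U (Inr (j, k)) = um j k" for j k by (simp_all add: U_def)
  note indep = indep[folded U_def]
  have up_indep: "indep_vars (\<lambda>_. borel) (\<lambda>j. up j k) {1..}" if "k \<in> {1..K}" for k
  proof -
    have "(\<lambda>j. Inl (j, k)) ` {1..} \<subseteq> particles K <+> particles L"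
      using that by (auto simp: particles_def)
    then have "indep_vars (\<lambda>_. borel) U ((\<lambda>j. Inl (j, k)) ` {1..})" by (rule indep_vars_subset[OF indep])
    then have "indep_vars (\<lambda>_. borel) (\<lambda>j. U (Inl (j, k))) {1..}"
      by (intro indep_vars_reindex[where f="\<lambda>j. Inl (j, k)" and M'="\<lambda>_. borel"]) (auto simp: inj_on_def)
    then show ?thesis by (simp only: U)
  qed
  have um_indep: "indep_vars (\<lambda>_. borel) (\<lambda>j. um j i) {1..}" if "i \<in> {1..L}" for i
  proof -
    have "(\<lambda>j. Inr (j, i)) ` {1..} \<subseteq> particles K <+> particles L"
      using that by (auto simp: particles_def)
    then have "indep_vars (\<lambda>_. borel) U ((\<lambda>j. Inr (j, i)) ` {1..})" by (rule indep_vars_subset[OF indep])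
    then have "indep_vars (\<lambda>_. borel) (\<lambda>j. U (Inr (j, i))) {1..}"
      by (intro indep_vars_reindex[where f="\<lambda>j. Inr (j, i)" and M'="\<lambda>_. borel"]) (auto simp: inj_on_def)
    then show ?thesis by (simp only: U)
  qed
  have up_rv: "random_variable borel (up 1 k)" if "k \<in> {1..K}" for k
    using up_int[OF that] by auto
  have um_rv: "random_variable borel (um 1 i)" if "i \<in> {1..L}" for i
    using um_int[OF that] by auto
  have mean_pos: "0 < expectation X" if "integrable M X" "AE \<omega> in M. 0 < X \<omega>" for X :: "'a \<Rightarrow> real"
    using integral_less_AE_space[of "\<lambda>_. 0" X] that by (simp add: emeasure_space_1)
  have sum_up: "initial_distance (\<lambda>j k. up j k \<omega>) p = (\<Sum>a\<in>Inl ` ({1..fst p} \<times> {snd p}). U a \<omega>)" for p \<omega>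
  proof -
    have eq: "(Inl :: particle \<Rightarrow> particle + particle) ` ({1..fst p} \<times> {snd p}) =
        (\<lambda>m. Inl (m, snd p)) ` {1..fst p}" by auto
    show ?thesis unfolding eq initial_distance_def by (subst sum.reindex) (auto simp: inj_on_def U)
  qed
  have sum_um: "initial_distance (\<lambda>j i. um j i \<omega>) q = (\<Sum>a\<in>Inr ` ({1..fst q} \<times> {snd q}). U a \<omega>)" for q \<omega>
  proof -
    have eq: "(Inr :: particle \<Rightarrow> particle + particle) ` ({1..fst q} \<times> {snd q}) =
        (\<lambda>m. Inr (m, snd q)) ` {1..fst q}" by auto
    show ?thesis unfolding eq initial_distance_def by (subst sum.reindex) (auto simp: inj_on_def U)
  qed
  have v_less: "vp k < vm i" if "k \<in> {1..K}" "i \<in> {1..L}" for k i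
    using vp(2)[OF that(1)] vm(2)[OF that(2)] by simp
  have vm_inj: "vm i \<noteq> vm i'" if "i \<in> {1..L}" "i' \<in> {1..L}" "i \<noteq> i'" for i i'
    using monotone_onD[OF vm(1), of i i'] monotone_onD[OF vm(1), of i' i] that
    by (metis less_irrefl nat_neq_iff)
  have vp_inj: "vp i \<noteq> vp i'" if "i \<in> {1..K}" "i' \<in> {1..K}" "i \<noteq> i'" for i i'
    using monotone_onD[OF vp(1), of i i'] monotone_onD[OF vp(1), of i' i] that
    by (metis less_irrefl nat_neq_iff)

  \<comment> \<open>The first gap of the type of \<open>p\<close> enters the two meeting times with different coefficients.\<close>
  have "AE \<omega> in M. meeting_time vp vm (\<lambda>j k. up j k \<omega>) (\<lambda>j i. um j i \<omega>) (p, q) \<noteq>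
      meeting_time vp vm (\<lambda>j k. up j k \<omega>) (\<lambda>j i. um j i \<omega>) (p, q')"
    if "p \<in> particles K" "q \<in> particles L" "q' \<in> particles L" "snd q \<noteq> snd q'" for p q q'
    unfolding meeting_time_def fst_conv snd_conv sum_up sum_um
  proof (rule AE_quotients_differ[where a="Inl (1, snd p)"])
    have t: "snd p \<in> {1..K}" "snd q \<in> {1..L}" "snd q' \<in> {1..L}" using that by (auto simp: particles_def)
    show "AE \<omega> in M. U (Inl (1, snd p)) \<omega> \<noteq> r" for r
      unfolding U using t up_rv up_ac by (intro AE_neq_of_absolutely_continuous) auto
    show "indep_vars (\<lambda>_. borel) U (Inl ` ({1..fst p} \<times> {snd p}) \<union> Inr ` ({1..fst q} \<times> {snd q}) \<union>
        Inr ` ({1..fst q'} \<times> {snd q'}))"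
      by (rule indep_vars_subset[OF indep]) (use t in \<open>auto simp: particles_def\<close>)
    show "vm (snd q) - vp (snd p) \<noteq> vm (snd q') - vp (snd p)" using vm_inj[OF t(2,3)] that by simp
    show "vm (snd q) - vp (snd p) \<noteq> 0" "vm (snd q') - vp (snd p) \<noteq> 0"
      using v_less[OF t(1,2)] v_less[OF t(1,3)] by auto
  qed (use that in \<open>auto simp: particles_def\<close>)
  then have tie_plus: "AE \<omega> in M. \<forall>p\<in>particles K. \<forall>q\<in>particles L. \<forall>q'\<in>particles L. snd q \<noteq> snd q' \<longrightarrow>
      meeting_time vp vm (\<lambda>j k. up j k \<omega>) (\<lambda>j i. um j i \<omega>) (p, q) \<noteq>
      meeting_time vp vm (\<lambda>j k. up j k \<omega>) (\<lambda>j i. um j i \<omega>) (p, q')"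
    by (auto simp: AE_ball_countable)

  have "AE \<omega> in M. meeting_time vp vm (\<lambda>j k. up j k \<omega>) (\<lambda>j i. um j i \<omega>) (p, q) \<noteq>
      meeting_time vp vm (\<lambda>j k. up j k \<omega>) (\<lambda>j i. um j i \<omega>) (p', q)"
    if "p \<in> particles K" "p' \<in> particles K" "q \<in> particles L" "snd p \<noteq> snd p'" for p p' q
    unfolding meeting_time_def fst_conv snd_conv sum_up sum_um add.commute[of "sum _ (Inl ` _)"]
  proof (rule AE_quotients_differ[where a="Inr (1, snd q)"])
    have t: "snd q \<in> {1..L}" "snd p \<in> {1..K}" "snd p' \<in> {1..K}" using that by (auto simp: particles_def)
    show "AE \<omega> in M. U (Inr (1, snd q)) \<omega> \<noteq> r" for r
      unfolding U using t um_rv um_ac by (intro AE_neq_of_absolutely_continuous) auto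
    show "indep_vars (\<lambda>_. borel) U (Inr ` ({1..fst q} \<times> {snd q}) \<union> Inl ` ({1..fst p} \<times> {snd p}) \<union>
        Inl ` ({1..fst p'} \<times> {snd p'}))"
      by (rule indep_vars_subset[OF indep]) (use t in \<open>auto simp: particles_def\<close>)
    show "vm (snd q) - vp (snd p) \<noteq> vm (snd q) - vp (snd p')" using vp_inj[OF t(2,3)] that by simp
    show "vm (snd q) - vp (snd p) \<noteq> 0" "vm (snd q) - vp (snd p') \<noteq> 0"
      using v_less[OF t(2,1)] v_less[OF t(3,1)] by auto
  qed (use that in \<open>auto simp: particles_def\<close>)
  then have tie_minus: "AE \<omega> in M. \<forall>p\<in>particles K. \<forall>p'\<in>particles K. \<forall>q\<in>particles L. snd p \<noteq> snd p' \<longrightarrow>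
      meeting_time vp vm (\<lambda>j k. up j k \<omega>) (\<lambda>j i. um j i \<omega>) (p, q) \<noteq>
      meeting_time vp vm (\<lambda>j k. up j k \<omega>) (\<lambda>j i. um j i \<omega>) (p', q)"
    by (auto simp: AE_ball_countable)

  have "AE \<omega> in M. \<forall>k\<in>{1..K}. (\<lambda>j. (\<Sum>m = 1..j. up m k \<omega>) / j) \<longlonglongrightarrow> expectation (up 1 k)"
    by (rule AE_finite_allI[OF finite_atLeastAtMost],
        rule strong_law_partial_sums[OF up_indep up_same up_int])
  moreover have "AE \<omega> in M. \<forall>i\<in>{1..L}. (\<lambda>j. (\<Sum>m = 1..j. um m i \<omega>) / j) \<longlonglongrightarrow> expectation (um 1 i)"
    by (rule AE_finite_allI[OF finite_atLeastAtMost],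
        rule strong_law_partial_sums[OF um_indep um_same um_int])
  moreover have "AE \<omega> in M. \<forall>j\<in>{1..}. \<forall>k\<in>{1..K}. 0 < up j k \<omega>"
    using up_pos by (auto simp: AE_ball_countable)
  moreover have "AE \<omega> in M. \<forall>j\<in>{1..}. \<forall>i\<in>{1..L}. 0 < um j i \<omega>"
    using um_pos by (auto simp: AE_ball_countable)
  ultimately show ?thesis using tie_plus tie_minus
  proof eventually_elim
    case (elim \<omega>)
    show ?case
    proof (rule boundary_velocity[OF K L vp vm, where mp="\<lambda>k. expectation (up 1 k)" and mm="\<lambda>i. expectation (um 1 i)"])
      show "0 < expectation (up 1 k)" if "k \<in> {1..K}" for k using mean_pos[OF up_int[OF that] up_pos[OF _ that]] by simp
      show "0 < expectation (um 1 i)" if "i \<in> {1..L}" for i using mean_pos[OF um_int[OF that] um_pos[OF _ that]] by simp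
      show "0 < up j k \<omega>" if "j \<ge> 1" "k \<in> {1..K}" for j k using elim(3) that by simp
      show "0 < um j i \<omega>" if "j \<ge> 1" "i \<in> {1..L}" for j i using elim(4) that by simp
      show "(\<lambda>j. (\<Sum>m = 1..j. up m k \<omega>) / j) \<longlonglongrightarrow> expectation (up 1 k)" if "k \<in> {1..K}" for k
        using elim(1) that by blast
      show "(\<lambda>j. (\<Sum>m = 1..j. um m i \<omega>) / j) \<longlonglongrightarrow> expectation (um 1 i)" if "i \<in> {1..L}" for i
        using elim(2) that by blast
      show "meeting_time vp vm (\<lambda>j k. up j k \<omega>) (\<lambda>j i. um j i \<omega>) (p, q) \<noteq>
          meeting_time vp vm (\<lambda>j k. up j k \<omega>) (\<lambda>j i. um j i \<omega>) (p, q')"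
        if "p \<in> particles K" "q \<in> particles L" "q' \<in> particles L" "snd q \<noteq> snd q'" for p q q'
        using elim(5) that by blast
      show "meeting_time vp vm (\<lambda>j k. up j k \<omega>) (\<lambda>j i. um j i \<omega>) (p, q) \<noteq>
          meeting_time vp vm (\<lambda>j k. up j k \<omega>) (\<lambda>j i. um j i \<omega>) (p', q)"
        if "p \<in> particles K" "p' \<in> particles K" "q \<in> particles L" "snd p \<noteq> snd p'" for p p' q
        using elim(6) that by blast
    qed (assumption | fact rp rm L1 K1)+
  qed
qed

end
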